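(* Let $\Omega\subset\mathbb R^n$ be open, and let $0<d<n$, $1\le b<\infty$ and $a>0$ satisfy $\bigl(1-\frac{n-d}{b}\bigr)a\ge n-d$. Let $g\in W^{1,b}(\Omega)$ with $|g|^{-a}\in L^1(\Omega)$. Then $\mathcal H^d(\{x\in\Omega:g(x)=0\})=0$. *)

theory Defs
  imports "HOL-Analysis.Analysis"
begin

coinductive smooth_fun :: "('a::euclidean_space \<Rightarrow> real) \<Rightarrow> bool" where
  "f differentiable_on UNIV \<Longrightarrow>
   (\<And>i. i \<in> Basis \<Longrightarrow> smooth_fun (\<lambda>x. frechet_derivative f (at x) i)) \<Longrightarrow>
   smooth_fun f"

definition test_fun :: "'a::euclidean_space set \<Rightarrow> ('a \<Rightarrow> real) \<Rightarrow> bool" where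
  "test_fun \<Omega> \<phi> \<longleftrightarrow> smooth_fun \<phi> \<and> compact (closure {x. \<phi> x \<noteq> 0})
      \<and> closure {x. \<phi> x \<noteq> 0} \<subseteq> \<Omega>"

definition Lp_on :: "real \<Rightarrow> 'a::euclidean_space set \<Rightarrow> ('a \<Rightarrow> real) \<Rightarrow> bool" where
  "Lp_on p \<Omega> f \<longleftrightarrow> set_borel_measurable lebesgue \<Omega> f
      \<and> set_integrable lebesgue \<Omega> (\<lambda>x. \<bar>f x\<bar> powr p)"

definition sobolev_W1 :: "real \<Rightarrow> 'a::euclidean_space set \<Rightarrow> ('a \<Rightarrow> real) \<Rightarrow> bool" where
  "sobolev_W1 p \<Omega> f \<longleftrightarrow> Lp_on p \<Omega> f \<and>
     (\<exists>G :: 'a \<Rightarrow> 'a. (\<forall>i\<in>Basis. Lp_on p \<Omega> (\<lambda>x. G x \<bullet> i)) \<and>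
        (\<forall>\<phi> i. test_fun \<Omega> \<phi> \<longrightarrow> i \<in> Basis \<longrightarrow>
           (LINT x:\<Omega>|lebesgue. f x * frechet_derivative \<phi> (at x) i)
             = - (LINT x:\<Omega>|lebesgue. (G x \<bullet> i) * \<phi> x)))"

definition hausdorff_const :: "real \<Rightarrow> real" where
  "hausdorff_const d = pi powr (d / 2) / Gamma (d / 2 + 1)"

definition hausdorff_pre :: "real \<Rightarrow> real \<Rightarrow> 'a::metric_space set \<Rightarrow> ennreal" where
  "hausdorff_pre d \<delta> A = (INF C \<in> {C :: nat \<Rightarrow> 'a set. A \<subseteq> (\<Union>i. C i) \<and>
        (\<forall>i. bounded (C i) \<and> diameter (C i) \<le> \<delta>)}.
      (\<Sum>i. ennreal (hausdorff_const d * (diameter (C i) / 2) powr d)))"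

definition hausdorff_measure :: "real \<Rightarrow> 'a::metric_space set \<Rightarrow> ennreal" where
  "hausdorff_measure d A = (SUP \<delta> \<in> {0<..}. hausdorff_pre d \<delta> A)"

definition neg_pow :: "real \<Rightarrow> real \<Rightarrow> ennreal" where
  "neg_pow a t = (if t = 0 then \<infinity> else ennreal (\<bar>t\<bar> powr (- a)))"

text \<open>Zero set of the precise representative: points x of Omega where the ball
averages of g tend to 0.\<close>
definition precise_zero_set :: "'a::euclidean_space set \<Rightarrow> ('a \<Rightarrow> real) \<Rightarrow> 'a set" where
  "precise_zero_set \<Omega> g = {x \<in> \<Omega>.
     ((\<lambda>r. (LINT y:ball x r|lebesgue. g y) / measure lebesgue (ball x r)) \<longlongrightarrow> 0) (at_right 0)}"

end

theory Submission
  imports Defs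
begin

text \<open>Put \<open>s = n - d\<close>, \<open>\<alpha> = 1 - s / b\<close> and \<open>f = \<bar>g\<bar>\<^sup>-\<^sup>a + \<bar>\<nabla>g\<bar>\<^sup>b\<close>. Suppose that the ball means of \<open>g\<close> at \<open>x\<close> tend
  to \<open>0\<close>, but that the integral of \<open>f\<close> over \<open>B(x, r)\<close> is smaller than \<open>\<epsilon> r\<^sup>d\<close> for all small \<open>r\<close>. The bound
  on the gradient and Poincare's inequality give mean oscillation \<open>O(\<epsilon>\<^sup>1\<^sup>/\<^sup>b r\<^sup>\<alpha>)\<close> on \<open>B(x, r)\<close>; as \<open>\<alpha> > 0\<close>,
  telescoping over dyadic radii shows that the mean of \<open>\<bar>g\<bar>\<close> over \<open>B(x, r)\<close> is \<open>O(\<epsilon>\<^sup>1\<^sup>/\<^sup>b r\<^sup>\<alpha>)\<close> as well. Hence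
  the integral of \<open>\<bar>g\<bar>\<^sup>-\<^sup>a\<close> over \<open>B(x, r)\<close> is at least \<open>c \<epsilon>\<^sup>-\<^sup>a\<^sup>/\<^sup>b r\<^sup>n\<^sup>-\<^sup>\<alpha>\<^sup>a\<close>, and \<open>\<alpha> a \<ge> s\<close> contradicts the upper
  bound \<open>\<epsilon> r\<^sup>d\<close> when \<open>\<epsilon>\<close> is small. So at every zero the integrable function \<open>f\<close> has upper \<open>d\<close>-density at
  least \<open>\<epsilon>\<close>, and by Vitali's covering lemma the set of such points is \<open>\<H>\<^sup>d\<close>-null because \<open>d < n\<close>.

  Poincare's inequality is obtained without mollification of \<open>g\<close>: testing the weak derivative along
  translates of a test function bounds the integral of \<open>\<bar>g(y + v) - g(y)\<bar>\<close> by \<open>\<bar>v\<bar>\<close> times that of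
  \<open>\<bar>\<nabla>g\<bar>\<close>, and one integrates over \<open>v\<close>.\<close>

section \<open>Smooth test functions\<close>

text \<open>The case \<open>k = 0\<close> is the classical smooth function that is flat at 0. The
  extra powers of \<open>inverse v\<close> make the family closed under differentiation up to linear
  combinations.\<close>

definition flat :: "nat \<Rightarrow> real \<Rightarrow> real" where
  "flat k v = (if v > 0 then exp (- inverse v) * inverse v ^ k else 0)"

text \<open>Away from 0 these are the product and chain rules. At 0 the difference quotient from the
  right is \<open>t ^ Suc k / exp t\<close> with \<open>t = inverse w\<close>, which tends to 0 as
  \<open>t\<close> grows; from the left it is 0.\<close>

lemma flat_has_derivative:
  "(flat k has_real_derivative (flat (k + 2) v - real k * flat (k + 1) v)) (at v)"
proof (cases v "0 :: real" rule: linorder_cases)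
  case less
  have "((\<lambda>_. 0) has_real_derivative 0) (at v)" by simp
  moreover have "\<forall>\<^sub>F w in nhds v. flat k w = 0"
    using eventually_nhds_in_open[of "{..<0}" v] less
    by (auto elim!: eventually_mono simp: flat_def)
  ultimately have "(flat k has_real_derivative 0) (at v)"
    by (subst DERIV_cong_ev[OF refl _ refl, where g = "\<lambda>_. 0"]) auto
  with less show ?thesis by (simp add: flat_def)
next
  case greater
  have D: "((\<lambda>w. exp (- inverse w) * inverse w ^ k) has_real_derivative
      flat (k + 2) v - real k * flat (k + 1) v) (at v)"
  proof -
    have inv: "(inverse has_real_derivative - (inverse v * inverse v)) (at v)"
      using DERIV_inverse[of v] greater by (simp add: power2_eq_square)
    have "((\<lambda>w. inverse w ^ k) has_real_derivative - (real k * inverse v ^ (k + 1))) (at v)"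
      using DERIV_power[OF inv, of k] by (cases k) (simp_all add: algebra_simps)
    moreover have "((\<lambda>w. exp (- inverse w)) has_real_derivative exp (- inverse v) * (inverse v * inverse v)) (at v)"
      using DERIV_chain2[OF DERIV_exp DERIV_minus[OF inv]] by simp
    ultimately have "((\<lambda>w. exp (- inverse w) * inverse w ^ k) has_real_derivative
        exp (- inverse v) * (inverse v * inverse v) * inverse v ^ k
          + - (real k * inverse v ^ (k + 1)) * exp (- inverse v)) (at v)"
      by (intro DERIV_mult)
    then show ?thesis
      by (rule DERIV_cong) (use greater in \<open>simp add: flat_def algebra_simps\<close>)
  qed
  have "\<forall>\<^sub>F w in nhds v. flat k w = exp (- inverse w) * inverse w ^ k"
    using eventually_nhds_in_open[of "{0<..}" v] greater
    by (auto elim!: eventually_mono simp: flat_def)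
  then show ?thesis
    using D by (subst DERIV_cong_ev[OF refl _ refl, where g = "\<lambda>w. exp (- inverse w) * inverse w ^ k"]) auto
next
  case equal
  have right: "((\<lambda>w. flat k w / w) \<longlongrightarrow> 0) (at_right 0)"
  proof (rule Lim_transform_eventually)
    show "((\<lambda>w::real. exp (- inverse w) * inverse w ^ k / w) \<longlongrightarrow> 0) (at_right 0)"
    proof (rule Lim_transform_eventually)
      show "((\<lambda>w::real. inverse w ^ Suc k / exp (inverse w)) \<longlongrightarrow> 0) (at_right 0)"
        by (rule filterlim_compose[OF tendsto_power_div_exp_0 filterlim_inverse_at_top_right])
      show "\<forall>\<^sub>F w in at_right (0::real). inverse w ^ Suc k / exp (inverse w) = exp (- inverse w) * inverse w ^ k / w"
        by (rule eventually_at_rightI[of _ 1]) (auto simp: exp_minus divide_inverse mult_ac)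
    qed
    show "\<forall>\<^sub>F w in at_right 0. exp (- inverse w) * inverse w ^ k / w = flat k w / w"
      by (rule eventually_at_rightI[of _ 1]) (auto simp: flat_def)
  qed
  have left: "((\<lambda>w. flat k w / w) \<longlongrightarrow> 0) (at_left 0)"
  proof (rule Lim_transform_eventually)
    show "((\<lambda>w::real. 0) \<longlongrightarrow> (0::real)) (at_left 0)" by simp
    show "\<forall>\<^sub>F w in at_left 0. 0 = flat k w / w"
      by (rule eventually_at_leftI[of "-1"]) (auto simp: flat_def)
  qed
  from left right have "((\<lambda>w. flat k w / w) \<longlongrightarrow> 0) (at 0)"
    by (simp add: filterlim_at_split)
  with equal show ?thesis
    by (simp add: has_field_derivative_iff flat_def)
qed

text \<open>Generators whose partial derivatives are again of the same form: this is the invariant for the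
  coinductive proof that the test functions below are smooth.\<close>

inductive smooth_gen :: "('a::euclidean_space \<Rightarrow> real) \<Rightarrow> bool" where
  const: "smooth_gen (\<lambda>x. c)"
| linear: "bounded_linear f \<Longrightarrow> smooth_gen f"
| add: "smooth_gen f \<Longrightarrow> smooth_gen g \<Longrightarrow> smooth_gen (\<lambda>x. f x + g x)"
| mult: "smooth_gen f \<Longrightarrow> smooth_gen g \<Longrightarrow> smooth_gen (\<lambda>x. f x * g x)"
| flat: "smooth_gen f \<Longrightarrow> smooth_gen (\<lambda>x. flat k (f x))"

text \<open>Induction over the generators, using the sum, product and chain rules. All directions
  \<open>i\<close> are treated at once, since \<open>D x i\<close> is formed from the same pieces
  for each of them.\<close>

lemma smooth_gen_derivative:
  assumes "smooth_gen f"
  shows "\<exists>D. (\<forall>x. (f has_derivative D x) (at x)) \<and> (\<forall>i. smooth_gen (\<lambda>x. D x i))"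
  using assms
proof induction
  case (const c)
  show ?case
    by (rule exI[of _ "\<lambda>_ _. 0"]) (auto intro: smooth_gen.const)
next
  case (linear f)
  then show ?case
    by (intro exI[of _ "\<lambda>_. f"]) (auto intro: smooth_gen.const bounded_linear_imp_has_derivative)
next
  case (add f g)
  then obtain D E where "\<And>x. (f has_derivative D x) (at x)" "\<And>i. smooth_gen (\<lambda>x. D x i)"
    "\<And>x. (g has_derivative E x) (at x)" "\<And>i. smooth_gen (\<lambda>x. E x i)" by auto
  then show ?case
    by (intro exI[of _ "\<lambda>x i. D x i + E x i"]) (auto intro: smooth_gen.add has_derivative_add)
next
  case (mult f g)
  then obtain D E where "\<And>x. (f has_derivative D x) (at x)" "\<And>i. smooth_gen (\<lambda>x. D x i)"
    "\<And>x. (g has_derivative E x) (at x)" "\<And>i. smooth_gen (\<lambda>x. E x i)" by auto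
  with mult.hyps show ?case
    by (intro exI[of _ "\<lambda>x i. f x * E x i + D x i * g x"])
       (auto intro!: smooth_gen.add smooth_gen.mult has_derivative_mult)
next
  case (flat f k)
  then obtain D where D: "\<And>x. (f has_derivative D x) (at x)" "\<And>i. smooth_gen (\<lambda>x. D x i)" by auto
  \<comment> \<open>The difference is written as a sum with the constant factor
    \<open>- real k\<close>, since the generators contain no subtraction.\<close>
  have "smooth_gen (\<lambda>x. D x i * (flat (k + 2) (f x) + (- real k) * flat (k + 1) (f x)))" for i
    by (intro smooth_gen.mult smooth_gen.add smooth_gen.flat smooth_gen.const flat.hyps D)
  moreover have "((\<lambda>x. flat k (f x)) has_derivative
      (\<lambda>i. D x i * (flat (k + 2) (f x) + (- real k) * flat (k + 1) (f x)))) (at x)" for x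
    using DERIV_compose_FDERIV[OF flat_has_derivative D(1)] by simp
  ultimately show ?case
    by (intro exI[of _ "\<lambda>x i. D x i * (flat (k + 2) (f x) + (- real k) * flat (k + 1) (f x))"]) auto
qed

lemma smooth_gen_imp_smooth_fun:
  assumes "smooth_gen f"
  shows "smooth_fun f"
  using assms
proof (coinduction arbitrary: f)
  case smooth_fun
  then obtain D where D: "\<And>x. (f has_derivative D x) (at x)" "\<And>i. smooth_gen (\<lambda>x. D x i)"
    using smooth_gen_derivative by blast
  have "frechet_derivative f (at x) = D x" for x
    using frechet_derivative_at[OF D(1)] by simp
  with D show ?case
    by (auto simp: differentiable_on_def intro: differentiableI differentiable_at_withinI)
qed

text \<open>Translation commutes with differentiation, so the translates of smooth functions form a
  coinduction invariant; the auxiliary facts are therefore proved for every smooth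
  \<open>f\<close>.\<close>

lemma smooth_fun_translate:
  fixes f :: "'a::euclidean_space \<Rightarrow> real"
  assumes "smooth_fun f"
  shows "smooth_fun (\<lambda>x. f (x - v))"
    and "frechet_derivative (\<lambda>x. f (x - v)) (at y) = frechet_derivative f (at (y - v))"
proof -
  have *: "((\<lambda>x. f (x - v)) has_derivative frechet_derivative f (at (y - v))) (at y)"
    if "smooth_fun f" for f :: "'a \<Rightarrow> real" and y
  proof -
    have "f differentiable (at (y - v))"
      using that by (cases rule: smooth_fun.cases) (auto simp: differentiable_on_def)
    then have "(f has_derivative frechet_derivative f (at (y - v))) (at (y - v))"
      by (rule frechet_derivative_works[THEN iffD1])
    moreover have "((\<lambda>x. x - v) has_derivative (\<lambda>x. x)) (at y)"
      by (auto intro!: derivative_eq_intros)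
    ultimately show ?thesis
      using has_derivative_compose[of "\<lambda>x. x - v" "\<lambda>x. x" y UNIV f] by simp
  qed
  have eq: "frechet_derivative (\<lambda>x. f (x - v)) (at y) = frechet_derivative f (at (y - v))"
    if "smooth_fun f" for f :: "'a \<Rightarrow> real" and y
    using frechet_derivative_at[OF *[OF that]] by simp
  show "frechet_derivative (\<lambda>x. f (x - v)) (at y) = frechet_derivative f (at (y - v))"
    by (rule eq[OF assms])
  show "smooth_fun (\<lambda>x. f (x - v))"
    using assms
  proof (coinduction arbitrary: f)
    case (smooth_fun f)
    have "smooth_fun (\<lambda>x. frechet_derivative f (at x) i)" if "i \<in> Basis" for i
      using smooth_fun that by (cases rule: smooth_fun.cases) auto
    moreover have "(\<lambda>x. f (x - v)) differentiable_on UNIV"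
      using *[OF smooth_fun] by (auto simp: differentiable_on_def intro: differentiableI)
    ultimately show ?case
      using eq[OF smooth_fun] by fastforce
  qed
qed

text \<open>Smoothness speaks of partial derivatives along \<open>Basis\<close> only; a general
  direction \<open>v\<close> is reached by expanding \<open>v\<close> in the basis and using
  linearity of the derivative.\<close>

lemma smooth_fun_derivative:
  fixes f :: "'a::euclidean_space \<Rightarrow> real"
  assumes "smooth_fun f"
  shows smooth_fun_has_derivative: "(f has_derivative frechet_derivative f (at x)) (at x)"
    and smooth_fun_continuous: "continuous_on UNIV f"
    and smooth_fun_continuous_derivative: "continuous_on UNIV (\<lambda>x. frechet_derivative f (at x) v)"
proof -
  have d: "f differentiable (at x)" if "smooth_fun f" for f :: "'a \<Rightarrow> real" and x
    using that by (cases rule: smooth_fun.cases) (auto simp: differentiable_on_def)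
  have c: "continuous_on UNIV f" if "smooth_fun f" for f :: "'a \<Rightarrow> real"
    using d[OF that] by (simp add: continuous_at_imp_continuous_on differentiable_imp_continuous_within)
  show D: "(f has_derivative frechet_derivative f (at x)) (at x)" for x
    using d[OF assms] by (rule frechet_derivative_works[THEN iffD1])
  show "continuous_on UNIV f" by (rule c[OF assms])
  have "smooth_fun (\<lambda>x. frechet_derivative f (at x) i)" if "i \<in> Basis" for i
    using assms that by (cases rule: smooth_fun.cases) auto
  then have "continuous_on UNIV (\<lambda>x. \<Sum>i\<in>Basis. (v \<bullet> i) * frechet_derivative f (at x) i)"
    by (intro continuous_intros c) auto
  moreover have "frechet_derivative f (at x) v = (\<Sum>i\<in>Basis. (v \<bullet> i) * frechet_derivative f (at x) i)" for x
  proof -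
    interpret bounded_linear "frechet_derivative f (at x)"
      using D by (rule has_derivative_bounded_linear)
    have "frechet_derivative f (at x) v = frechet_derivative f (at x) (\<Sum>i\<in>Basis. (v \<bullet> i) *\<^sub>R i)"
      by (simp add: euclidean_representation)
    then show ?thesis by (simp add: sum scale)
  qed
  ultimately show "continuous_on UNIV (\<lambda>x. frechet_derivative f (at x) v)" by simp
qed

section \<open>Translation estimate and Poincare inequality\<close>

text \<open>By the mean value theorem the difference quotients of \<open>k\<close> are bounded by
  \<open>C\<close>, so \<open>C * \<bar>u y\<bar>\<close> dominates and dominated convergence
  applies.\<close>

lemma has_real_derivative_lebesgue_integral:
  fixes k k' :: "real \<Rightarrow> 'a \<Rightarrow> real"
  assumes u: "integrable M u"
    and meas: "\<And>t. k t \<in> borel_measurable M" "\<And>t. k' t \<in> borel_measurable M"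
    and D: "\<And>t y. ((\<lambda>t. k t y) has_real_derivative k' t y) (at t)"
    and bound: "\<And>t y. \<bar>k t y\<bar> \<le> C\<^sub>0" "\<And>t y. \<bar>k' t y\<bar> \<le> C"
  shows "((\<lambda>t. \<integral>y. u y * k t y \<partial>M) has_real_derivative (\<integral>y. u y * k' t y \<partial>M)) (at t)"
proof -
  note [measurable] = meas borel_measurable_integrable[OF u]
  have int: "integrable M (\<lambda>y. u y * k s y)" for s
  proof (rule Bochner_Integration.integrable_bound)
    show "integrable M (\<lambda>y. C\<^sub>0 * u y)" using u by simp
    show "AE y in M. norm (u y * k s y) \<le> norm (C\<^sub>0 * u y)"
    proof (intro AE_I2)
      fix y
      have "\<bar>k s y\<bar> \<le> \<bar>C\<^sub>0\<bar>" using bound(1)[of s y] by linarith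
      then show "norm (u y * k s y) \<le> norm (C\<^sub>0 * u y)"
        by (simp add: abs_mult mult.commute[of "\<bar>C\<^sub>0\<bar>"] mult_left_mono)
    qed
  qed simp
  have lip: "\<bar>k s y - k t y\<bar> \<le> C * \<bar>s - t\<bar>" for s t y
    using field_differentiable_bound[of UNIV "\<lambda>t. k t y" "\<lambda>t. k' t y" C s t] D bound(2) by simp
  have "((\<lambda>s. ((\<integral>y. u y * k s y \<partial>M) - (\<integral>y. u y * k t y \<partial>M)) / (s - t)) \<longlongrightarrow> (\<integral>y. u y * k' t y \<partial>M)) (at t)"
    \<comment> \<open>Dominated convergence is a statement about sequences, so the limit is tested
      along sequences avoiding \<open>t\<close>.\<close>
    unfolding tendsto_at_iff_sequentially
  proof (intro allI impI)
    fix X :: "nat \<Rightarrow> real" assume X: "\<forall>i. X i \<in> UNIV - {t}" "X \<longlonglongrightarrow> t"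
    have "(\<lambda>i. \<integral>y. u y * ((k (X i) y - k t y) / (X i - t)) \<partial>M) \<longlonglongrightarrow> (\<integral>y. u y * k' t y \<partial>M)"
    proof (rule integral_dominated_convergence[where w = "\<lambda>y. C * \<bar>u y\<bar>"])
      show "integrable M (\<lambda>y. C * \<bar>u y\<bar>)" using u by simp
      show "AE y in M. (\<lambda>i. u y * ((k (X i) y - k t y) / (X i - t))) \<longlonglongrightarrow> u y * k' t y"
      proof (intro AE_I2 tendsto_mult tendsto_const)
        fix y
        show "(\<lambda>i. (k (X i) y - k t y) / (X i - t)) \<longlonglongrightarrow> k' t y"
          using D[of y t] X unfolding has_field_derivative_iff tendsto_at_iff_sequentially
          by (auto simp: o_def)
      qed
      show "AE y in M. norm (u y * ((k (X i) y - k t y) / (X i - t))) \<le> C * \<bar>u y\<bar>" for i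
      proof (intro AE_I2)
        fix y
        have "X i \<noteq> t" using X by auto
        then have "\<bar>(k (X i) y - k t y) / (X i - t)\<bar> \<le> C"
          using lip[of "X i" y t] by (simp add: divide_simps)
        then show "norm (u y * ((k (X i) y - k t y) / (X i - t))) \<le> C * \<bar>u y\<bar>"
          unfolding real_norm_def abs_mult by (subst mult.commute) (rule mult_right_mono, auto)
      qed
    qed simp_all
    moreover have "(\<integral>y. u y * ((k s y - k t y) / (s - t)) \<partial>M) = ((\<integral>y. u y * k s y \<partial>M) - (\<integral>y. u y * k t y \<partial>M)) / (s - t)" for s
    proof -
      have "(\<integral>y. u y * ((k s y - k t y) / (s - t)) \<partial>M) = (\<integral>y. (u y * k s y - u y * k t y) / (s - t) \<partial>M)"
        by (intro Bochner_Integration.integral_cong) (auto simp: algebra_simps)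
      then show ?thesis using int by simp
    qed
    ultimately show "((\<lambda>s. ((\<integral>y. u y * k s y \<partial>M) - (\<integral>y. u y * k t y \<partial>M)) / (s - t)) \<circ> X) \<longlonglongrightarrow> (\<integral>y. u y * k' t y \<partial>M)"
      by (simp only: o_def)
  qed
  then show ?thesis by (simp add: has_field_derivative_iff)
qed

lemma integral_lborel_translate:
  fixes f :: "'a::euclidean_space \<Rightarrow> real"
  assumes [measurable]: "f \<in> borel_measurable borel"
  shows "(\<integral>y. f (y + v) \<partial>lborel) = (\<integral>y. f y \<partial>lborel)"
proof -
  have "(\<integral>y. f y \<partial>lborel) = (\<integral>y. f y \<partial>distr lborel borel ((+) v))"
    by (simp only: lborel_distr_plus)
  also have "\<dots> = (\<integral>y. f (v + y) \<partial>lborel)"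
    by (subst integral_distr) auto
  finally show ?thesis by (simp add: add.commute)
qed

lemma nn_integral_lborel_translate:
  fixes f :: "'a::euclidean_space \<Rightarrow> ennreal"
  assumes [measurable]: "f \<in> borel_measurable borel"
  shows "(\<integral>\<^sup>+y. f (v + y) \<partial>lborel) = (\<integral>\<^sup>+y. f y \<partial>lborel)"
proof -
  have "(\<integral>\<^sup>+y. f y \<partial>lborel) = (\<integral>\<^sup>+y. f y \<partial>distr lborel borel ((+) v))"
    by (simp only: lborel_distr_plus)
  also have "\<dots> = (\<integral>\<^sup>+y. f (v + y) \<partial>lborel)"
    by (subst nn_integral_distr) auto
  finally show ?thesis by simp
qed

lemma integrable_lborel_translate:
  fixes f :: "'a::euclidean_space \<Rightarrow> real"
  assumes f: "integrable lborel f"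
  shows "integrable lborel (\<lambda>y. f (y + v))"
proof -
  have "integrable (distr lborel borel ((+) v)) f"
    using f by (simp only: lborel_distr_plus)
  then have "integrable lborel (\<lambda>y. f (v + y))"
    by (subst (asm) integrable_distr_eq) (use f in auto)
  then show ?thesis by (simp add: add.commute)
qed

lemma continuous_compact_support_bounded:
  fixes f :: "'a::euclidean_space \<Rightarrow> real"
  assumes "continuous_on UNIV f" "\<And>y. y \<notin> cball x R \<Longrightarrow> f y = 0"
  shows "\<exists>C. \<forall>y. \<bar>f y\<bar> \<le> C"
proof -
  have "bounded (f ` cball x R)"
    using assms(1) by (intro compact_imp_bounded compact_continuous_image) (auto intro: continuous_on_subset)
  then obtain B where "\<And>y. y \<in> cball x R \<Longrightarrow> \<bar>f y\<bar> \<le> B"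
    unfolding bounded_iff by (metis imageI real_norm_def)
  then have "\<bar>f y\<bar> \<le> max B 0" for y
    using assms(2)[of y] by (cases "y \<in> cball x R") fastforce+
  then show ?thesis by blast
qed

lemma smooth_fun_derivative_outside:
  assumes "smooth_fun \<phi>" "\<And>y. y \<notin> cball x R \<Longrightarrow> \<phi> y = 0" "y \<notin> cball x R"
  shows "frechet_derivative \<phi> (at y) v = 0"
proof -
  have "((\<lambda>_. 0) has_derivative (\<lambda>_. 0)) (at y)" by simp
  then have "(\<phi> has_derivative (\<lambda>_. 0)) (at y)"
    by (rule has_derivative_transform_within_open[of _ _ _ _ "- cball x R"]) (use assms in auto)
  then show ?thesis
    using frechet_derivative_at by metis
qed

text \<open>The integration by parts is required only for test functions vanishing outside
  \<open>cball x S\<close>. This admits functions cut off to zero outside the ball, whose jump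
  across the sphere is then invisible.\<close>

locale weak_gradient_ball =
  fixes x :: "'a::euclidean_space" and S :: real
    and u :: "'a \<Rightarrow> real" and D :: "'a \<Rightarrow> 'a \<Rightarrow> real"
  assumes integrable_u: "integrable lborel u"
    and integrable_D: "\<And>i. i \<in> Basis \<Longrightarrow> integrable lborel (D i)"
    and weak_derivative: "\<And>\<phi> i. smooth_fun \<phi> \<Longrightarrow> (\<And>y. y \<notin> cball x S \<Longrightarrow> \<phi> y = 0) \<Longrightarrow> i \<in> Basis \<Longrightarrow>
      (\<integral>y. u y * frechet_derivative \<phi> (at y) i \<partial>lborel) = - (\<integral>y. D i y * \<phi> y \<partial>lborel)"
begin

definition grad_norm :: real where
  "grad_norm = (\<Sum>i\<in>Basis. \<integral>y. \<bar>D i y\<bar> \<partial>lborel)"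

lemma grad_norm_nonneg: "0 \<le> grad_norm"
  unfolding grad_norm_def by (intro sum_nonneg) auto

lemma u_borel [measurable]: "u \<in> borel_measurable borel"
  using integrable_u by auto

text \<open>The function \<open>t \<mapsto> \<integral> u(y) \<phi>(y - t v) dy\<close> interpolates between the two integrals, and its
  derivative is a pairing with the weak gradient.\<close>

lemma difference_pairing_le:
  assumes \<phi>: "smooth_fun \<phi>" "\<And>y. y \<notin> cball x R \<Longrightarrow> \<phi> y = 0" "\<And>y. \<bar>\<phi> y\<bar> \<le> 1"
    and v: "norm v + R \<le> S"
  shows "\<bar>\<integral>y. (u (y + v) - u y) * \<phi> y \<partial>lborel\<bar> \<le> norm v * grad_norm"
proof -
  define A where "A t = (\<integral>y. u y * \<phi> (y - t *\<^sub>R v) \<partial>lborel)" for t :: real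
  define A' where "A' t = (\<integral>y. u y * - frechet_derivative \<phi> (at (y - t *\<^sub>R v)) v \<partial>lborel)" for t :: real
  define q where "q y = frechet_derivative \<phi> (at y) v" for y
  have q0: "q y = 0" if "y \<notin> cball x R" for y
    unfolding q_def using smooth_fun_derivative_outside[OF \<phi>(1,2) that] .
  have cont: "continuous_on UNIV q" "continuous_on UNIV \<phi>"
    unfolding q_def using \<phi>(1) by (rule smooth_fun_continuous_derivative smooth_fun_continuous)+
  then have [measurable]: "q \<in> borel_measurable borel" "\<phi> \<in> borel_measurable borel"
    by (auto intro: borel_measurable_continuous_onI)
  obtain C where C: "\<And>y. \<bar>q y\<bar> \<le> C"
    using continuous_compact_support_bounded[OF cont(1) q0] by metis
  have der: "(A has_real_derivative A' t) (at t)" for t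
    unfolding A_def A'_def q_def[symmetric]
  proof (rule has_real_derivative_lebesgue_integral[OF integrable_u, where C\<^sub>0 = 1 and C = C])
    show "((\<lambda>t. \<phi> (y - t *\<^sub>R v)) has_real_derivative - q (y - t *\<^sub>R v)) (at t)" for t y
    proof -
      have "((\<lambda>t. y - t *\<^sub>R v) has_derivative (\<lambda>s. - (s *\<^sub>R v))) (at t)"
        by (auto intro!: derivative_eq_intros)
      from has_derivative_compose[OF this smooth_fun_has_derivative[OF \<phi>(1)]]
      have *: "((\<lambda>t. \<phi> (y - t *\<^sub>R v)) has_derivative
          (\<lambda>s. frechet_derivative \<phi> (at (y - t *\<^sub>R v)) (- (s *\<^sub>R v)))) (at t)" .
      interpret L: bounded_linear "frechet_derivative \<phi> (at (y - t *\<^sub>R v))"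
        using smooth_fun_has_derivative[OF \<phi>(1)] by (rule has_derivative_bounded_linear)
      show ?thesis
        using * unfolding has_field_derivative_def q_def
        by (rule has_derivative_eq_rhs) (simp add: fun_eq_iff L.neg L.scale mult.commute)
    qed
  qed (use \<phi>(3) C in auto)
  \<comment> \<open>For \<open>t\<close> in [0, 1] the translate of \<open>\<phi>\<close> by
    \<open>t *\<^sub>R v\<close> still vanishes outside \<open>cball x S\<close>, because
    \<open>norm v + R \<le> S\<close>; it is thus an admissible test function.\<close>
  have A'_le: "\<bar>A' t\<bar> \<le> norm v * grad_norm" if t: "0 \<le> t" "t \<le> 1" for t
  proof -
    define \<psi> where "\<psi> y = \<phi> (y - t *\<^sub>R v)" for y
    have \<psi>: "smooth_fun \<psi>" "frechet_derivative \<psi> (at y) = frechet_derivative \<phi> (at (y - t *\<^sub>R v))" for y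
      unfolding \<psi>_def using smooth_fun_translate[OF \<phi>(1)] by auto
    have supp: "\<psi> y = 0" if "y \<notin> cball x S" for y
    proof -
      have "dist x y \<le> dist x (y - t *\<^sub>R v) + norm (t *\<^sub>R v)"
        using dist_triangle[of x y "y - t *\<^sub>R v"] by (simp add: dist_norm)
      moreover have "norm (t *\<^sub>R v) \<le> norm v"
        using t by (simp add: mult_left_le_one_le)
      ultimately show ?thesis
        using that v unfolding \<psi>_def by (intro \<phi>(2)) auto
    qed
    have [measurable]: "\<psi> \<in> borel_measurable borel"
      unfolding \<psi>_def by measurable
    have "A' t = (\<integral>y. (\<Sum>i\<in>Basis. - (v \<bullet> i) * (u y * frechet_derivative \<psi> (at y) i)) \<partial>lborel)"
      unfolding A'_def
    proof (intro Bochner_Integration.integral_cong refl)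
      fix y
      interpret L: bounded_linear "frechet_derivative \<phi> (at (y - t *\<^sub>R v))"
        using smooth_fun_has_derivative[OF \<phi>(1)] by (rule has_derivative_bounded_linear)
      have "frechet_derivative \<phi> (at (y - t *\<^sub>R v)) v
          = frechet_derivative \<phi> (at (y - t *\<^sub>R v)) (\<Sum>i\<in>Basis. (v \<bullet> i) *\<^sub>R i)"
        by (simp add: euclidean_representation)
      then show "u y * - frechet_derivative \<phi> (at (y - t *\<^sub>R v)) v
          = (\<Sum>i\<in>Basis. - (v \<bullet> i) * (u y * frechet_derivative \<psi> (at y) i))"
        by (simp add: L.sum L.scale \<psi> sum_distrib_left sum_negf mult_ac)
    qed
    also have "\<dots> = (\<Sum>i\<in>Basis. - (v \<bullet> i) * (\<integral>y. u y * frechet_derivative \<psi> (at y) i \<partial>lborel))"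
    proof (subst Bochner_Integration.integral_sum)
      fix i :: 'a assume "i \<in> Basis"
      have c: "continuous_on UNIV (\<lambda>y. frechet_derivative \<psi> (at y) i)"
        by (rule smooth_fun_continuous_derivative[OF \<psi>(1)])
      have "\<exists>B. \<forall>y. \<bar>frechet_derivative \<psi> (at y) i\<bar> \<le> B"
        by (rule continuous_compact_support_bounded[OF c smooth_fun_derivative_outside[OF \<psi>(1) supp]])
      then obtain B where B: "\<And>y. \<bar>frechet_derivative \<psi> (at y) i\<bar> \<le> B" by metis
      have "integrable lborel (\<lambda>y. u y * frechet_derivative \<psi> (at y) i)"
      proof (rule Bochner_Integration.integrable_bound)
        show "integrable lborel (\<lambda>y. B * u y)" using integrable_u by simp
        show "(\<lambda>y. u y * frechet_derivative \<psi> (at y) i) \<in> borel_measurable lborel"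
          using c by (auto intro!: borel_measurable_times intro: borel_measurable_continuous_onI)
        show "AE y in lborel. norm (u y * frechet_derivative \<psi> (at y) i) \<le> norm (B * u y)"
        proof (intro AE_I2)
          fix y
          have "\<bar>frechet_derivative \<psi> (at y) i\<bar> \<le> \<bar>B\<bar>" using B[of y] by linarith
          then show "norm (u y * frechet_derivative \<psi> (at y) i) \<le> norm (B * u y)"
            by (simp add: abs_mult mult.commute[of "\<bar>B\<bar>"] mult_left_mono)
        qed
      qed
      then show "integrable lborel (\<lambda>y. - (v \<bullet> i) * (u y * frechet_derivative \<psi> (at y) i))"
        by simp
    qed simp
    also have "\<dots> = (\<Sum>i\<in>Basis. (v \<bullet> i) * (\<integral>y. D i y * \<psi> y \<partial>lborel))"
      using weak_derivative[OF \<psi>(1) supp] by (intro sum.cong) auto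
    finally have "\<bar>A' t\<bar> \<le> (\<Sum>i\<in>Basis. \<bar>(v \<bullet> i) * (\<integral>y. D i y * \<psi> y \<partial>lborel)\<bar>)"
      by (simp add: sum_abs)
    also have "\<dots> \<le> (\<Sum>i\<in>Basis. norm v * (\<integral>y. \<bar>D i y\<bar> \<partial>lborel))"
    proof (rule sum_mono)
      fix i :: 'a assume i: "i \<in> Basis"
      have m [measurable]: "D i \<in> borel_measurable borel"
        using integrable_D[OF i] by auto
      have le: "\<bar>D i y * \<psi> y\<bar> \<le> \<bar>D i y\<bar>" for y
        using \<phi>(3)[of "y - t *\<^sub>R v"] by (auto simp: abs_mult \<psi>_def intro: mult_right_le_one_le)
      have int: "integrable lborel (\<lambda>y. D i y * \<psi> y)"
        by (rule Bochner_Integration.integrable_bound[OF integrable_D[OF i]]) (use le in auto)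
      have "\<bar>\<integral>y. D i y * \<psi> y \<partial>lborel\<bar> \<le> (\<integral>y. \<bar>D i y * \<psi> y\<bar> \<partial>lborel)"
        by (rule integral_abs_bound)
      also have "\<dots> \<le> (\<integral>y. \<bar>D i y\<bar> \<partial>lborel)"
        using int integrable_D[OF i] le by (intro integral_mono) auto
      finally show "\<bar>(v \<bullet> i) * (\<integral>y. D i y * \<psi> y \<partial>lborel)\<bar> \<le> norm v * (\<integral>y. \<bar>D i y\<bar> \<partial>lborel)"
        using Basis_le_norm[OF i, of v] unfolding abs_mult by (intro mult_mono) auto
    qed
    finally show ?thesis by (simp add: grad_norm_def sum_distrib_left)
  qed
  obtain t where t: "0 < t" "t < 1" "A 1 - A 0 = A' t"
    using MVT2[of 0 1 A A'] der by auto
  have int1: "integrable lborel (\<lambda>y. u (y + w) * \<phi> y)" for w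
    by (rule Bochner_Integration.integrable_bound[OF integrable_lborel_translate[OF integrable_u, of w]])
      (use \<phi>(3) in \<open>auto simp: abs_mult intro!: mult_right_le_one_le\<close>)
  \<comment> \<open>Translation invariance moves the shift from \<open>u\<close> to
    \<open>\<phi>\<close>, which identifies the pairing with \<open>A 1 - A 0\<close>.\<close>
  have "(\<integral>y. (u (y + v) - u y) * \<phi> y \<partial>lborel)
      = (\<integral>y. u (y + v) * \<phi> (y + v - v) \<partial>lborel) - (\<integral>y. u y * \<phi> y \<partial>lborel)"
    using int1[of v] int1[of 0] by (simp add: left_diff_distrib)
  also have "(\<integral>y. u (y + v) * \<phi> (y + v - v) \<partial>lborel) = (\<integral>y. u y * \<phi> (y - v) \<partial>lborel)"
    by (rule integral_lborel_translate) simp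
  finally have "(\<integral>y. (u (y + v) - u y) * \<phi> y \<partial>lborel) = A' t"
    using t by (simp add: A_def)
  with A'_le[of t] t show ?thesis by simp
qed

end

section \<open>Duality with polynomials\<close>

text \<open>The optimal multiplier is \<open>sgn (w y)\<close>. It is an almost everywhere limit of
  continuous functions, and these are uniformly close to polynomials on the ball. Polynomials are
  chosen because their products with a bump function are smooth test functions.\<close>

lemma integral_abs_le_polynomial_duality:
  fixes w :: "'a::euclidean_space \<Rightarrow> real"
  assumes w: "integrable lborel w" and supp: "\<And>y. y \<notin> cball x R \<Longrightarrow> w y = 0"
    and dual: "\<And>p. real_polynomial_function p \<Longrightarrow> (\<And>y. y \<in> cball x R \<Longrightarrow> \<bar>p y\<bar> \<le> 1) \<Longrightarrow>
      (\<integral>y. w y * p y \<partial>lborel) \<le> M"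
  shows "(\<integral>y. \<bar>w y\<bar> \<partial>lborel) \<le> M"
proof -
  have [measurable]: "w \<in> borel_measurable borel" using w by auto
  have "(\<lambda>y. sgn (w y)) \<in> borel_measurable lborel"
    unfolding sgn_if by measurable
  then have "(\<lambda>y. sgn (w y)) \<in> borel_measurable (lebesgue_on UNIV)"
    by (simp add: lebesgue_on_UNIV_eq measurable_completion)
  then have "(\<lambda>y. sgn (w y)) measurable_on UNIV"
    using measurable_on_iff_borel_measurable[of UNIV "\<lambda>y. sgn (w y)"] by simp
  then obtain N g where N: "negligible N" and g: "\<And>n::nat. continuous_on UNIV (g n)"
    and lim: "\<And>y. y \<notin> N \<Longrightarrow> (\<lambda>n. g n y) \<longlonglongrightarrow> sgn (w y)"
    unfolding measurable_on_def by auto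
  \<comment> \<open>Clipping to [-1, 1] keeps the limit, as \<open>sgn\<close> takes values there,
    and supplies the uniform bound.\<close>
  define \<psi> where "\<psi> n y = max (-1) (min 1 (g n y))" for n y
  have "\<exists>p. real_polynomial_function p \<and> (\<forall>y\<in>cball x R. \<bar>\<psi> n y - p y\<bar> < inverse (real (Suc n)))" for n
  proof -
    have "continuous_on (cball x R) (\<psi> n)"
      unfolding \<psi>_def using continuous_on_subset[OF g[of n]] by (intro continuous_intros) auto
    then show ?thesis
      using Stone_Weierstrass_real_polynomial_function[of "cball x R" "\<psi> n" "inverse (real (Suc n))"]
      by (metis compact_cball inverse_positive_iff_positive of_nat_0_less_iff zero_less_Suc)
  qed
  then obtain p where p: "\<And>n. real_polynomial_function (p n)"
    "\<And>n y. y \<in> cball x R \<Longrightarrow> \<bar>\<psi> n y - p n y\<bar> < inverse (real (Suc n))"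
    by metis
  \<comment> \<open>The approximation error may push \<open>p n\<close> above 1 in absolute value,
    by at most \<open>inverse (real (Suc n))\<close>; this factor restores the bound and tends to
    1.\<close>
  define q where "q n y = inverse (1 + inverse (real (Suc n))) * p n y" for n y
  have q_poly: "real_polynomial_function (q n)" for n
    unfolding q_def by (intro real_polynomial_function.intros(4)[OF real_polynomial_function.intros(2)] p)
  have q_le: "\<bar>q n y\<bar> \<le> 1" if "y \<in> cball x R" for n y
  proof -
    have "\<bar>\<psi> n y\<bar> \<le> 1" by (auto simp: \<psi>_def)
    with p(2)[OF that, of n] have "\<bar>p n y\<bar> \<le> 1 + inverse (real (Suc n))" by linarith
    then show ?thesis
      unfolding q_def abs_mult by (simp add: divide_simps mult.commute split: if_splits)
  qed
  have q_lim: "(\<lambda>n. q n y) \<longlonglongrightarrow> sgn (w y)" if "y \<notin> N" "y \<in> cball x R" for y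
  proof -
    have "(\<lambda>n. max (-1) (min 1 (g n y))) \<longlonglongrightarrow> max (-1) (min 1 (sgn (w y)))"
      by (intro tendsto_intros lim that)
    then have "(\<lambda>n. \<psi> n y) \<longlonglongrightarrow> sgn (w y)"
      by (simp add: \<psi>_def sgn_if split: if_splits)
    moreover have "(\<lambda>n. \<psi> n y - p n y) \<longlonglongrightarrow> 0"
      by (rule tendsto_0_le[OF LIMSEQ_inverse_real_of_nat, of _ 1])
        (use p(2)[OF that(2)] in \<open>auto intro!: always_eventually less_imp_le\<close>)
    ultimately have "(\<lambda>n. \<psi> n y - (\<psi> n y - p n y)) \<longlonglongrightarrow> sgn (w y) - 0"
      by (intro tendsto_diff)
    then have "(\<lambda>n. inverse (1 + inverse (real (Suc n))) * p n y) \<longlonglongrightarrow> inverse (1 + 0) * sgn (w y)"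
      by (intro tendsto_intros LIMSEQ_inverse_real_of_nat) auto
    then show ?thesis by (simp add: q_def)
  qed
  have AE: "AE y in lborel. y \<notin> N"
    using N by (metis AE_completion_iff AE_not_in negligible_iff_null_sets)
  have meas: "q n \<in> borel_measurable borel" for n
    using q_poly[of n] by (intro borel_measurable_continuous_onI continuous_on_polymonial_function)
      (simp add: real_polynomial_function_eq)
  have "(\<lambda>n. \<integral>y. w y * q n y \<partial>lborel) \<longlonglongrightarrow> (\<integral>y. \<bar>w y\<bar> \<partial>lborel)"
  proof (rule integral_dominated_convergence[where w = "\<lambda>y. \<bar>w y\<bar>"])
    show "AE y in lborel. (\<lambda>n. w y * q n y) \<longlonglongrightarrow> \<bar>w y\<bar>"
      using AE
    proof eventually_elim
      case (elim y)
      show ?case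
      proof (cases "y \<in> cball x R")
        case True
        have "(\<lambda>n. w y * q n y) \<longlonglongrightarrow> w y * sgn (w y)"
          by (intro tendsto_intros q_lim elim True)
        then show ?thesis by (simp add: abs_sgn[symmetric] mult.commute)
      qed (use supp in auto)
    qed
    show "AE y in lborel. norm (w y * q n y) \<le> \<bar>w y\<bar>" for n
    proof (intro AE_I2)
      fix y show "norm (w y * q n y) \<le> \<bar>w y\<bar>"
        using supp[of y] q_le[of y n]
        by (cases "y \<in> cball x R") (auto simp: abs_mult intro: mult_right_le_one_le)
    qed
  qed (use w meas in auto)
  then show ?thesis
    by (rule LIMSEQ_le_const2) (use dual[OF q_poly q_le] in auto)
qed

section \<open>Bump functions\<close>

lemma real_polynomial_imp_smooth_gen:
  "real_polynomial_function p \<Longrightarrow> smooth_gen p"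
  by (induction rule: real_polynomial_function.induct) (auto intro: smooth_gen.intros)

text \<open>The standard bump function of \<open>ball x R\<close>, not normalised. The squared norm
  makes the argument of \<open>flat\<close> a polynomial in the coordinates, hence a smooth
  generator.\<close>

definition bump :: "'a::euclidean_space \<Rightarrow> real \<Rightarrow> 'a \<Rightarrow> real" where
  "bump x R y = flat 0 (1 - (norm (y - x))\<^sup>2 / R\<^sup>2)"

lemma smooth_gen_bump: "smooth_gen (bump x R)"
proof -
  have *: "(norm (y - x))\<^sup>2 = (\<Sum>i\<in>Basis. (y \<bullet> i - x \<bullet> i) * (y \<bullet> i - x \<bullet> i))" for y
    using euclidean_inner[of "y - x" "y - x"] by (simp only: power2_norm_eq_inner inner_diff_left)
  have "real_polynomial_function (\<lambda>y. 1 - (norm (y - x))\<^sup>2 / R\<^sup>2)"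
    unfolding *
    by (intro real_polynomial_function_diff real_polynomial_function_divide real_polynomial_function_sum
        real_polynomial_function.intros bounded_linear_inner_left finite_Basis)
  then show ?thesis
    unfolding bump_def by (intro smooth_gen.flat real_polynomial_imp_smooth_gen)
qed

lemma bump_bounds: "0 \<le> bump x R y" "bump x R y \<le> 1"
  by (auto simp: bump_def flat_def)

lemma bump_outside:
  assumes "0 < R" "y \<notin> cball x R"
  shows "bump x R y = 0"
proof -
  have "R\<^sup>2 \<le> (norm (y - x))\<^sup>2"
    using assms by (intro power_mono) (auto simp: dist_norm norm_minus_commute)
  then have "1 \<le> (norm (y - x))\<^sup>2 / R\<^sup>2" using assms(1) by (simp add: le_divide_eq)
  then show ?thesis by (simp add: bump_def flat_def)
qed

text \<open>On the ball of half the radius the argument of \<open>flat\<close> is at least 3/4,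
  whence the exponent -4/3.\<close>

lemma bump_ge:
  assumes "y \<in> ball x r" "R = 2 * r"
  shows "exp (- 4 / 3) \<le> bump x R y"
proof -
  have r: "0 < r" using assms(1) by (metis ball_eq_empty empty_iff not_le)
  have "(norm (y - x))\<^sup>2 \<le> r\<^sup>2"
    using assms(1) by (intro power_mono) (auto simp: dist_norm norm_minus_commute)
  then have *: "3 / 4 \<le> 1 - (norm (y - x))\<^sup>2 / R\<^sup>2"
    using r assms(2) by (simp add: field_simps power2_eq_square)
  then have "inverse (1 - (norm (y - x))\<^sup>2 / R\<^sup>2) \<le> inverse (3 / 4)"
    by (intro le_imp_inverse_le) auto
  moreover from * have "0 < 1 - (norm (y - x))\<^sup>2 / R\<^sup>2" by linarith
  ultimately show ?thesis unfolding bump_def flat_def by (simp only: if_True power_0 mult_1_right exp_le_cancel_iff) simp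
qed

section \<open>From translation estimates to Poincare's inequality\<close>

context weak_gradient_ball
begin

text \<open>Duality upgrades \<open>difference_pairing_le\<close> from a pairing to an absolute
  value. The bump is kept as a weight so that \<open>bump x R y * p y\<close> is smooth, vanishes
  outside the ball and is at most 1 in absolute value everywhere, although \<open>p\<close> is
  controlled on the ball only.\<close>

lemma translation_bump_le:
  assumes R: "0 < R" and v: "norm v + R \<le> S"
  shows "(\<integral>y. \<bar>u (y + v) - u y\<bar> * bump x R y \<partial>lborel) \<le> norm v * grad_norm"
proof -
  have [measurable]: "bump x R \<in> borel_measurable borel"
    by (intro borel_measurable_continuous_onI smooth_fun_continuous smooth_gen_imp_smooth_fun smooth_gen_bump)
  have int: "integrable lborel (\<lambda>y. (u (y + v) - u y) * bump x R y)"
  proof (rule Bochner_Integration.integrable_bound)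
    show "integrable lborel (\<lambda>y. u (y + v) - u y)"
      using integrable_u integrable_lborel_translate[OF integrable_u] by auto
  qed (auto simp: abs_mult bump_bounds intro!: mult_right_le_one_le)
  have "(\<integral>y. \<bar>(u (y + v) - u y) * bump x R y\<bar> \<partial>lborel) \<le> norm v * grad_norm"
  proof (rule integral_abs_le_polynomial_duality[OF int])
    show "(u (y + v) - u y) * bump x R y = 0" if "y \<notin> cball x R" for y
      using bump_outside[OF R that] by simp
    fix p :: "'a \<Rightarrow> real"
    assume p: "real_polynomial_function p" "\<And>y. y \<in> cball x R \<Longrightarrow> \<bar>p y\<bar> \<le> 1"
    have "\<bar>bump x R y * p y\<bar> \<le> 1" for y
      using p(2)[of y] bump_bounds[of x R y] bump_outside[OF R, of y]
      by (cases "y \<in> cball x R") (auto simp: abs_mult intro: mult_le_one)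
    then have "\<bar>\<integral>y. (u (y + v) - u y) * (bump x R y * p y) \<partial>lborel\<bar> \<le> norm v * grad_norm"
      using v bump_outside[OF R]
      by (intro difference_pairing_le[where R = R] smooth_gen_imp_smooth_fun smooth_gen.mult smooth_gen_bump
          real_polynomial_imp_smooth_gen p(1)) auto
    then show "(\<integral>y. (u (y + v) - u y) * bump x R y * p y \<partial>lborel) \<le> norm v * grad_norm"
      by (simp add: mult.assoc)
  qed
  then show ?thesis by (simp add: abs_mult bump_bounds)
qed

text \<open>The bump of radius \<open>2 * r\<close> is at least \<open>exp (- 4 / 3)\<close> on
  \<open>ball x r\<close>, so removing it costs the factor \<open>exp (4 / 3)\<close>. The bump
  radius and the shift together stay within \<open>4 * r = S\<close>.\<close>

lemma translation_le:
  assumes r: "0 < r" and S: "S = 4 * r" and v: "norm v \<le> 2 * r"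
  shows "(\<integral>\<^sup>+y. ennreal \<bar>u (v + y) - u y\<bar> * indicator (ball x r) y \<partial>lborel)
    \<le> ennreal (2 * r * exp (4 / 3) * grad_norm)"
proof -
  have [measurable]: "bump x (2 * r) \<in> borel_measurable borel"
    by (intro borel_measurable_continuous_onI smooth_fun_continuous smooth_gen_imp_smooth_fun smooth_gen_bump)
  have int: "integrable lborel (\<lambda>y. exp (4 / 3) * (\<bar>u (v + y) - u y\<bar> * bump x (2 * r) y))"
  proof (rule Bochner_Integration.integrable_bound)
    show "integrable lborel (\<lambda>y. exp (4 / 3) * (u (y + v) - u y))"
      using integrable_u integrable_lborel_translate[OF integrable_u] by auto
  qed (auto simp: abs_mult bump_bounds add.commute intro!: mult_right_le_one_le)
  have "(\<integral>\<^sup>+y. ennreal \<bar>u (v + y) - u y\<bar> * indicator (ball x r) y \<partial>lborel)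
      \<le> (\<integral>\<^sup>+y. ennreal (exp (4 / 3) * (\<bar>u (v + y) - u y\<bar> * bump x (2 * r) y)) \<partial>lborel)"
  proof (intro nn_integral_mono)
    fix y
    show "ennreal \<bar>u (v + y) - u y\<bar> * indicator (ball x r) y
        \<le> ennreal (exp (4 / 3) * (\<bar>u (v + y) - u y\<bar> * bump x (2 * r) y))"
    proof (cases "y \<in> ball x r")
      case True
      have "1 \<le> exp (4 / 3) * bump x (2 * r) y"
        using bump_ge[OF True refl] by (simp add: exp_minus field_simps)
      then have "\<bar>u (v + y) - u y\<bar> * 1 \<le> \<bar>u (v + y) - u y\<bar> * (exp (4 / 3) * bump x (2 * r) y)"
        by (rule mult_left_mono) simp
      with True show ?thesis by (simp add: ennreal_leI mult_ac)
    qed simp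
  qed
  also have "\<dots> = ennreal (exp (4 / 3) * (\<integral>y. \<bar>u (y + v) - u y\<bar> * bump x (2 * r) y \<partial>lborel))"
    using int by (subst nn_integral_eq_integral) (auto simp: bump_bounds add.commute)
  also have "\<dots> \<le> ennreal (exp (4 / 3) * (2 * r * grad_norm))"
  proof -
    have "(\<integral>y. \<bar>u (y + v) - u y\<bar> * bump x (2 * r) y \<partial>lborel) \<le> norm v * grad_norm"
      using r S v by (intro translation_bump_le) auto
    also have "\<dots> \<le> 2 * r * grad_norm"
      using v grad_norm_nonneg by (intro mult_right_mono) auto
    finally show ?thesis by (intro ennreal_leI mult_left_mono) auto
  qed
  finally show ?thesis by (simp add: mult_ac)
qed

text \<open>Substitute \<open>z = y + v\<close>, exchange the integrals, and apply
  \<open>translation_le\<close> for each fixed \<open>v\<close>.\<close>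

lemma double_oscillation_le:
  assumes r: "0 < r" and S: "S = 4 * r"
  shows "(\<integral>\<^sup>+y. (\<integral>\<^sup>+z. ennreal \<bar>u z - u y\<bar> * indicator (ball x r) z \<partial>lborel) * indicator (ball x r) y \<partial>lborel)
    \<le> ennreal (2 * r * exp (4 / 3) * grad_norm) * emeasure lborel (ball (0::'a) (2 * r))"
proof -
  have [measurable]: "ball c s \<in> sets borel" for c :: 'a and s by simp
  have "(\<integral>\<^sup>+y. (\<integral>\<^sup>+z. ennreal \<bar>u z - u y\<bar> * indicator (ball x r) z \<partial>lborel) * indicator (ball x r) y \<partial>lborel)
     = (\<integral>\<^sup>+y. (\<integral>\<^sup>+v. ennreal \<bar>u (y + v) - u y\<bar> * indicator (ball x r) (y + v) \<partial>lborel) * indicator (ball x r) y \<partial>lborel)"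
  proof (rule nn_integral_cong)
    fix y
    have "(\<integral>\<^sup>+z. ennreal \<bar>u z - u y\<bar> * indicator (ball x r) z \<partial>lborel)
        = (\<integral>\<^sup>+v. ennreal \<bar>u (y + v) - u y\<bar> * indicator (ball x r) (y + v) \<partial>lborel)"
      by (rule nn_integral_lborel_translate[symmetric, where f = "\<lambda>z. ennreal \<bar>u z - u y\<bar> * indicator (ball x r) z"]) measurable
    then show "(\<integral>\<^sup>+z. ennreal \<bar>u z - u y\<bar> * indicator (ball x r) z \<partial>lborel) * indicator (ball x r) y
        = (\<integral>\<^sup>+v. ennreal \<bar>u (y + v) - u y\<bar> * indicator (ball x r) (y + v) \<partial>lborel) * indicator (ball x r) y"
      by (simp only:)
  qed
  \<comment> \<open>Two points of \<open>ball x r\<close> differ by less than \<open>2 * r\<close>.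
    The condition on \<open>y + v\<close> is relaxed to one on \<open>v\<close> alone, so that the
    inner integral after the exchange has the form treated above.\<close>
  also have "\<dots> \<le> (\<integral>\<^sup>+y. (\<integral>\<^sup>+v. ennreal \<bar>u (v + y) - u y\<bar> * indicator (ball x r) y * indicator (ball 0 (2 * r)) v \<partial>lborel) \<partial>lborel)"
  proof (intro nn_integral_mono)
    fix y
    show "(\<integral>\<^sup>+v. ennreal \<bar>u (y + v) - u y\<bar> * indicator (ball x r) (y + v) \<partial>lborel) * indicator (ball x r) y
      \<le> (\<integral>\<^sup>+v. ennreal \<bar>u (v + y) - u y\<bar> * indicator (ball x r) y * indicator (ball 0 (2 * r)) v \<partial>lborel)"
    proof (cases "y \<in> ball x r")
      case True
      have "v \<in> ball 0 (2 * r)" if "y + v \<in> ball x r" for v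
      proof -
        have "norm v \<le> dist x (y + v) + dist x y"
          using dist_triangle3[of "y + v" y x] by (simp add: dist_norm norm_minus_commute)
        then show ?thesis using that True by simp
      qed
      with True show ?thesis
        by (auto intro!: nn_integral_mono simp: indicator_def add.commute)
    qed simp
  qed
  also have "\<dots> = (\<integral>\<^sup>+v. (\<integral>\<^sup>+y. ennreal \<bar>u (v + y) - u y\<bar> * indicator (ball x r) y * indicator (ball 0 (2 * r)) v \<partial>lborel) \<partial>lborel)"
    by (rule lborel_pair.Fubini') measurable
  also have "\<dots> = (\<integral>\<^sup>+v. (\<integral>\<^sup>+y. ennreal \<bar>u (v + y) - u y\<bar> * indicator (ball x r) y \<partial>lborel) * indicator (ball 0 (2 * r)) v \<partial>lborel)"
    by (intro nn_integral_cong nn_integral_multc) measurable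
  also have "\<dots> \<le> (\<integral>\<^sup>+v. ennreal (2 * r * exp (4 / 3) * grad_norm) * indicator (ball (0::'a) (2 * r)) v \<partial>lborel)"
  proof (intro nn_integral_mono)
    fix v :: 'a
    show "(\<integral>\<^sup>+y. ennreal \<bar>u (v + y) - u y\<bar> * indicator (ball x r) y \<partial>lborel) * indicator (ball 0 (2 * r)) v
      \<le> ennreal (2 * r * exp (4 / 3) * grad_norm) * indicator (ball (0::'a) (2 * r)) v"
      using translation_le[OF r S, of v] by (auto simp: indicator_def)
  qed
  also have "\<dots> = ennreal (2 * r * exp (4 / 3) * grad_norm) * emeasure lborel (ball (0::'a) (2 * r))"
    by (rule nn_integral_cmult_indicator) simp
  finally show ?thesis .
qed

definition mean :: "real \<Rightarrow> real" where
  "mean r = (\<integral>y. u y * indicator (ball x r) y \<partial>lborel) / measure lborel (ball x r)"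

text \<open>Multiplied by the volume \<open>m\<close>, the deviation of \<open>u y\<close> from the
  mean is at most the integral of \<open>\<bar>u z - u y\<bar>\<close> over \<open>z\<close> in the
  ball. Integrating in \<open>y\<close> gives the double oscillation, whose bound contains the
  volume \<open>2 ^ DIM('a) * m\<close>; finally \<open>m\<close> cancels.\<close>

lemma poincare:
  assumes r: "0 < r" and S: "S = 4 * r"
  shows "(\<integral>y. \<bar>u y - mean r\<bar> * indicator (ball x r) y \<partial>lborel)
    \<le> 2 ^ (DIM('a) + 1) * exp (4 / 3) * r * grad_norm"
proof -
  define m where "m = measure lborel (ball x r)"
  have em: "emeasure lborel (ball x r) = ennreal m"
    unfolding m_def by (intro emeasure_eq_ennreal_measure) (simp add: emeasure_ball r less_imp_le)
  have m: "0 < m" using r by (simp add: m_def)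
  have em2: "emeasure lborel (ball (0::'a) (2 * r)) = ennreal (2 ^ DIM('a) * m)"
    using r by (simp add: m_def emeasure_ball content_ball power_mult_distrib mult_ac)
  have iu: "integrable lborel (\<lambda>y. u y * indicator (ball x r) y)"
    using integrable_mult_indicator[OF _ integrable_u, of "ball x r"] by (simp add: mult.commute)
  have ind: "integrable lborel (indicator (ball x r) :: 'a \<Rightarrow> real)"
    using em by (intro integrable_real_indicator) auto
  have diff: "integrable lborel (\<lambda>y. (u y - c) * indicator (ball x r) y)" for c
    using Bochner_Integration.integrable_diff[OF iu Bochner_Integration.integrable_mult_right[OF ind, of c]]
    by (simp add: left_diff_distrib)
  have absd: "integrable lborel (\<lambda>y. \<bar>u y - c\<bar> * indicator (ball x r) y)" for c
    using integrable_abs[OF diff[of c]] by (simp add: abs_mult)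
  have "ennreal (m * (\<integral>y. \<bar>u y - mean r\<bar> * indicator (ball x r) y \<partial>lborel))
      = (\<integral>\<^sup>+y. ennreal (m * \<bar>u y - mean r\<bar>) * indicator (ball x r) y \<partial>lborel)"
  proof -
    have "(\<integral>\<^sup>+y. ennreal (m * \<bar>u y - mean r\<bar>) * indicator (ball x r) y \<partial>lborel)
        = (\<integral>\<^sup>+y. ennreal (m * (\<bar>u y - mean r\<bar> * indicator (ball x r) y)) \<partial>lborel)"
      by (intro nn_integral_cong) (auto simp: indicator_def)
    also have "\<dots> = ennreal (\<integral>y. m * (\<bar>u y - mean r\<bar> * indicator (ball x r) y) \<partial>lborel)"
      using m by (intro nn_integral_eq_integral Bochner_Integration.integrable_mult_right absd) auto
    finally show ?thesis by simp
  qed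
  also have "\<dots> \<le> (\<integral>\<^sup>+y. (\<integral>\<^sup>+z. ennreal \<bar>u z - u y\<bar> * indicator (ball x r) z \<partial>lborel) * indicator (ball x r) y \<partial>lborel)"
  proof (intro nn_integral_mono mult_right_mono)
    fix y
    have "(\<integral>z. (u z - u y) * indicator (ball x r) z \<partial>lborel) = m * mean r - u y * m"
    proof -
      have "(\<integral>z. (u z - u y) * indicator (ball x r) z \<partial>lborel)
          = (\<integral>z. u z * indicator (ball x r) z \<partial>lborel) - (\<integral>z. u y * indicator (ball x r) z \<partial>lborel)"
        using iu ind by (simp add: left_diff_distrib)
      then show ?thesis using m by (simp add: mean_def m_def[symmetric])
    qed
    then have "m * \<bar>u y - mean r\<bar> = \<bar>\<integral>z. (u z - u y) * indicator (ball x r) z \<partial>lborel\<bar>"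
      using m by (simp add: abs_mult abs_minus_commute flip: right_diff_distrib mult.commute[of m])
    also have "\<dots> \<le> (\<integral>z. \<bar>(u z - u y) * indicator (ball x r) z\<bar> \<partial>lborel)"
      by (rule integral_abs_bound)
    also have "\<dots> = (\<integral>z. \<bar>u z - u y\<bar> * indicator (ball x r) z \<partial>lborel)"
      by (simp add: abs_mult)
    finally have "ennreal (m * \<bar>u y - mean r\<bar>) \<le> ennreal \<dots>" by (rule ennreal_leI)
    also have "\<dots> = (\<integral>\<^sup>+z. ennreal (\<bar>u z - u y\<bar> * indicator (ball x r) z) \<partial>lborel)"
      by (rule nn_integral_eq_integral[symmetric]) (use absd in auto)
    also have "\<dots> = (\<integral>\<^sup>+z. ennreal \<bar>u z - u y\<bar> * indicator (ball x r) z \<partial>lborel)"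
      by (intro nn_integral_cong) (auto simp: indicator_def)
    finally show "ennreal (m * \<bar>u y - mean r\<bar>) \<le> (\<integral>\<^sup>+z. ennreal \<bar>u z - u y\<bar> * indicator (ball x r) z \<partial>lborel)" .
  qed simp
  also have "\<dots> \<le> ennreal (2 * r * exp (4 / 3) * grad_norm) * ennreal (2 ^ DIM('a) * m)"
    using double_oscillation_le[OF r S] unfolding em2 .
  also have "\<dots> = ennreal (m * (2 ^ (DIM('a) + 1) * exp (4 / 3) * r * grad_norm))"
    using r m grad_norm_nonneg by (simp add: mult_ac flip: ennreal_mult)
  finally have "m * (\<integral>y. \<bar>u y - mean r\<bar> * indicator (ball x r) y \<partial>lborel)
      \<le> m * (2 ^ (DIM('a) + 1) * exp (4 / 3) * r * grad_norm)"
    using r m grad_norm_nonneg by (subst (asm) ennreal_le_iff) auto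
  then show ?thesis using m by (simp only: mult_le_cancel_left_pos)
qed

end

section \<open>Points of positive upper density\<close>

text \<open>Split \<open>f\<close> into its truncation at a level \<open>n\<close>, which
  contributes at most \<open>n\<close> times the measure of \<open>A\<close>, and a remainder with
  integral below \<open>e / 2\<close>.\<close>

lemma integral_absolutely_continuous:
  fixes f :: "'a \<Rightarrow> real"
  assumes f: "integrable M f" and nonneg: "\<And>x. 0 \<le> f x" and e: "0 < e"
  obtains k where "0 < k"
    "\<And>A. A \<in> sets M \<Longrightarrow> emeasure M A \<le> ennreal k \<Longrightarrow> (\<integral>\<^sup>+x. ennreal (f x) * indicator A x \<partial>M) \<le> ennreal e"
proof -
  have [measurable]: "f \<in> borel_measurable M" using f by auto
  have mi: "integrable M (\<lambda>x. min (f x) (real n))" for n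
    by (rule Bochner_Integration.integrable_bound[OF f]) (auto simp: nonneg)
  have "(\<lambda>n. \<integral>x. min (f x) (real n) \<partial>M) \<longlonglongrightarrow> (\<integral>x. f x \<partial>M)"
  proof (rule integral_dominated_convergence[OF _ _ f])
    show "AE x in M. (\<lambda>n. min (f x) (real n)) \<longlonglongrightarrow> f x"
    proof (intro AE_I2 tendsto_eventually)
      fix x
      show "\<forall>\<^sub>F n in sequentially. min (f x) (real n) = f x"
        using eventually_ge_at_top[of "nat \<lceil>f x\<rceil>"] by eventually_elim linarith
    qed
  qed (auto simp: nonneg)
  then have "\<forall>\<^sub>F n in sequentially. dist (\<integral>x. min (f x) (real n) \<partial>M) (\<integral>x. f x \<partial>M) < e / 2"
    using e by (intro tendstoD) auto
  then obtain n where "dist (\<integral>x. min (f x) (real n) \<partial>M) (\<integral>x. f x \<partial>M) < e / 2"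
    unfolding eventually_sequentially by blast
  then have n: "(\<integral>x. f x \<partial>M) - (\<integral>x. min (f x) (real n) \<partial>M) < e / 2"
    unfolding dist_real_def by linarith
  show ?thesis
  proof (rule that)
    \<comment> \<open>The added 1 covers the truncation level \<open>n = 0\<close>.\<close>
    show "0 < e / (2 * (real n + 1))" using e by simp
    fix A assume A: "A \<in> sets M" "emeasure M A \<le> ennreal (e / (2 * (real n + 1)))"
    have "(\<integral>\<^sup>+x. ennreal (f x) * indicator A x \<partial>M)
        \<le> (\<integral>\<^sup>+x. ennreal (f x - min (f x) (real n)) + ennreal (real n) * indicator A x \<partial>M)"
      by (intro nn_integral_mono) (auto simp: indicator_def nonneg simp flip: ennreal_plus intro!: ennreal_leI)
    also have "\<dots> = (\<integral>\<^sup>+x. ennreal (f x - min (f x) (real n)) \<partial>M) + ennreal (real n) * emeasure M A"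
      using A(1) by (subst nn_integral_add) (auto simp: nn_integral_cmult_indicator)
    also have "(\<integral>\<^sup>+x. ennreal (f x - min (f x) (real n)) \<partial>M) = ennreal (\<integral>x. f x - min (f x) (real n) \<partial>M)"
      using f mi by (intro nn_integral_eq_integral) auto
    also have "\<dots> \<le> ennreal (e / 2)"
      using n f mi by (intro ennreal_leI) auto
    also have "ennreal (real n) * emeasure M A \<le> ennreal (real n) * ennreal (e / (2 * (real n + 1)))"
      by (intro mult_left_mono A) auto
    also have "\<dots> = ennreal (real n * (e / (2 * (real n + 1))))"
      using e by (intro ennreal_mult[symmetric]) auto
    also have "\<dots> \<le> ennreal (e / 2)"
      using e by (intro ennreal_leI) (simp add: field_simps)
    also have "ennreal (e / 2) + ennreal (e / 2) = ennreal e"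
      using e by (simp flip: ennreal_plus)
    finally show "(\<integral>\<^sup>+x. ennreal (f x) * indicator A x \<partial>M) \<le> ennreal e" by (simp add: add_mono)
  qed
qed

lemma Vitali_covering_sequence:
  fixes Z :: "'a::euclidean_space set"
  assumes r: "\<And>x. x \<in> Z \<Longrightarrow> 0 < r x \<and> r x \<le> B"
  shows "\<exists>(s :: nat \<Rightarrow> real) c. (\<forall>n. s n = 0 \<or> c n \<in> Z \<and> s n = r (c n)) \<and>
    disjoint_family (\<lambda>n. ball (c n) (s n)) \<and> Z \<subseteq> (\<Union>n. ball (c n) (5 * s n))"
proof -
  obtain C where C: "countable C" "C \<subseteq> Z"
      "pairwise (\<lambda>i j. disjnt (cball i (r i)) (cball j (r j))) C"
    and cov: "\<And>i. i \<in> Z \<Longrightarrow> \<exists>j. j \<in> C \<and> \<not> disjnt (cball i (r i)) (cball j (r j)) \<and>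
                        cball i (r i) \<subseteq> ball j (5 * r j)"
    by (rule Vitali_covering_lemma_cballs_balls[of Z r B "\<lambda>x. x"]) (use r in auto)
  define c where "c = from_nat_into C"
  define s where "s n = (if n \<in> to_nat_on C ` C then r (c n) else 0)" for n
  have c: "c n \<in> C" "to_nat_on C (c n) = n" if "n \<in> to_nat_on C ` C" for n
    using that C(1) by (auto simp: c_def)
  show ?thesis
  proof (intro exI conjI allI)
    show "s n = 0 \<or> c n \<in> Z \<and> s n = r (c n)" for n
      using c C(2) by (auto simp: s_def)
    show "disjoint_family (\<lambda>n. ball (c n) (s n))"
      unfolding disjoint_family_on_def
    proof (intro ballI impI)
      fix m n :: nat assume "m \<noteq> n"
      show "ball (c m) (s m) \<inter> ball (c n) (s n) = {}"
      proof (cases "m \<in> to_nat_on C ` C \<and> n \<in> to_nat_on C ` C")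
        case True
        then have "disjnt (cball (c m) (r (c m))) (cball (c n) (r (c n)))"
          using c[of m] c[of n] \<open>m \<noteq> n\<close> C(3) unfolding pairwise_def by metis
        then have "ball (c m) (r (c m)) \<inter> ball (c n) (r (c n)) = {}"
          unfolding disjnt_def using ball_subset_cball by blast
        with True show ?thesis by (simp add: s_def)
      qed (auto simp: s_def)
    qed
    show "Z \<subseteq> (\<Union>n. ball (c n) (5 * s n))"
    proof
      fix x assume x: "x \<in> Z"
      then obtain j where j: "j \<in> C" "cball x (r x) \<subseteq> ball j (5 * r j)" using cov by blast
      have "x \<in> cball x (r x)" using r[OF x] by simp
      then have "x \<in> ball (c (to_nat_on C j)) (5 * s (to_nat_on C j))"
        using j C(1) by (auto simp: s_def c_def simp del: mem_ball mem_cball)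
      then show "x \<in> (\<Union>n. ball (c n) (5 * s n))" by blast
    qed
  qed
qed

lemma hausdorff_const_pos: "0 \<le> d \<Longrightarrow> 0 < hausdorff_const d"
  unfolding hausdorff_const_def by (auto intro!: divide_pos_pos Gamma_real_pos)

text \<open>Disjoint Vitali balls with union \<open>E\<close> satisfy: the sum of
  \<open>s n powr d\<close> is at most \<open>1 / e\<close> times the integral of \<open>f\<close>
  over \<open>E\<close>. Used first with the total integral \<open>I\<close>, this shows that
  \<open>E\<close> has small volume, because \<open>d < DIM('a)\<close> and the radii are small.
  Absolute continuity then makes the integral over \<open>E\<close> small, and the same bound used
  again makes the Hausdorff sum small.\<close>

lemma hausdorff_measure_dense_points_eq_0:
  fixes f :: "'a::euclidean_space \<Rightarrow> real" and d :: real
  assumes f: "integrable lborel f" and nonneg: "\<And>x. 0 \<le> f x"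
    and d: "0 < d" "d < DIM('a)" and e: "0 < e"
    and dense: "\<And>x \<delta>. x \<in> Z \<Longrightarrow> 0 < \<delta> \<Longrightarrow>
      \<exists>r. 0 < r \<and> r < \<delta> \<and> e * r powr d \<le> (\<integral>y. f y * indicator (ball x r) y \<partial>lborel)"
  shows "hausdorff_measure d Z = 0"
proof -
  have [measurable]: "f \<in> borel_measurable borel" using f by auto
  define \<nu> where "\<nu> A = (\<integral>\<^sup>+y. ennreal (f y) * indicator A y \<partial>lborel)" for A
  define I where "I = (\<integral>y. f y \<partial>lborel)"
  define \<omega> where "\<omega> = unit_ball_vol (real DIM('a))"
  have I: "0 \<le> I" unfolding I_def using nonneg by simp
  have \<omega>: "0 < \<omega>" by (simp add: \<omega>_def)
  have pre_le: "hausdorff_pre d \<delta> Z \<le> ennreal \<eta>" if \<delta>: "0 < \<delta>" and \<eta>: "0 < \<eta>" for \<delta> \<eta>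
  proof -
    define h where "h = hausdorff_const d * 5 powr d"
    have h: "0 < h" using hausdorff_const_pos[of d] d by (simp add: h_def)
    have "0 < \<eta> * e / h" using \<eta> e h by simp
    from integral_absolutely_continuous[OF f nonneg this]
    obtain \<kappa> where \<kappa>: "0 < \<kappa>" and ac: "\<And>A. A \<in> sets lborel \<Longrightarrow> emeasure lborel A \<le> ennreal \<kappa> \<Longrightarrow> \<nu> A \<le> ennreal (\<eta> * e / h)"
      unfolding \<nu>_def by metis
    define \<beta> where "\<beta> = real DIM('a) - d"
    have \<beta>: "0 < \<beta>" using d by (simp add: \<beta>_def)
    \<comment> \<open>The first entry keeps the diameters \<open>10 * s n\<close> of the enlarged
      balls below \<open>\<delta>\<close>; the second makes the volume of \<open>E\<close> at most
      \<open>\<kappa>\<close>. Using \<open>I + 1\<close> avoids a division by zero when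
      \<open>I = 0\<close>.\<close>
    define \<rho> where "\<rho> = min (\<delta> / 10) ((\<kappa> * e / (\<omega> * (I + 1))) powr (1 / \<beta>))"
    have \<rho>: "0 < \<rho>" "\<rho> \<le> \<delta> / 10" using \<delta> \<kappa> e \<omega> I by (auto simp: \<rho>_def)
    have "\<rho> powr \<beta> \<le> ((\<kappa> * e / (\<omega> * (I + 1))) powr (1 / \<beta>)) powr \<beta>"
      using \<rho> \<beta> by (intro powr_mono2) (auto simp: \<rho>_def)
    also have "\<dots> = \<kappa> * e / (\<omega> * (I + 1))"
      using \<beta> \<kappa> e \<omega> I by (simp add: powr_powr)
    finally have \<rho>_powr: "\<omega> * \<rho> powr \<beta> * (I + 1) \<le> \<kappa> * e"
      using \<omega> I by (subst (asm) pos_le_divide_eq) (auto simp: mult_ac)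
    obtain r where r: "\<And>x. x \<in> Z \<Longrightarrow> 0 < r x \<and> r x < \<rho> \<and>
        e * r x powr d \<le> (\<integral>y. f y * indicator (ball x (r x)) y \<partial>lborel)"
      using dense[OF _ \<rho>(1)] by metis
    have r_bound: "0 < r x \<and> r x \<le> \<rho>" if "x \<in> Z" for x using r[OF that] by simp
    obtain c :: "nat \<Rightarrow> 'a" and s :: "nat \<Rightarrow> real" where cs: "\<And>n. s n = 0 \<or> c n \<in> Z \<and> s n = r (c n)"
      and disj: "disjoint_family (\<lambda>n. ball (c n) (s n))" and cov: "Z \<subseteq> (\<Union>n. ball (c n) (5 * s n))"
      using Vitali_covering_sequence[of Z r \<rho>, OF r_bound] by blast
    have s: "0 \<le> s n" "s n \<le> \<rho>" for n
      using cs[of n] r[of "c n"] \<rho> by auto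
    define E where "E = (\<Union>n. ball (c n) (s n))"
    have \<nu>_ball: "ennreal (e * s n powr d) \<le> \<nu> (ball (c n) (s n))" for n
    proof -
      have "integrable lborel (\<lambda>y. f y * indicator (ball (c n) (s n)) y)"
        using integrable_mult_indicator[OF _ f, of "ball (c n) (s n)"] by (simp add: mult.commute)
      then have "\<nu> (ball (c n) (s n)) = ennreal (\<integral>y. f y * indicator (ball (c n) (s n)) y \<partial>lborel)"
        unfolding \<nu>_def by (subst nn_integral_eq_integral[symmetric])
          (auto simp: nonneg indicator_def intro!: nn_integral_cong)
      then show ?thesis
        using cs[of n] r[of "c n"] by (auto intro: ennreal_leI)
    qed
    have \<nu>E: "(\<Sum>n. \<nu> (ball (c n) (s n))) = \<nu> E"
    proof -
      have *: "\<nu> A = emeasure (density lborel (\<lambda>y. ennreal (f y))) A" if "A \<in> sets lborel" for A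
        unfolding \<nu>_def using that by (simp add: emeasure_density)
      have "(\<Sum>n. emeasure (density lborel (\<lambda>y. ennreal (f y))) (ball (c n) (s n)))
          = emeasure (density lborel (\<lambda>y. ennreal (f y))) E"
        unfolding E_def by (rule suminf_emeasure) (use disj in auto)
      then show ?thesis by (simp add: * E_def)
    qed
    have sum_le: "(\<Sum>n. ennreal (s n powr d)) \<le> ennreal (1 / e) * \<nu> E"
    proof -
      have "(\<Sum>n. ennreal (s n powr d)) = (\<Sum>n. ennreal (1 / e) * ennreal (e * s n powr d))"
        using e by (intro suminf_cong) (simp flip: ennreal_mult)
      also have "\<dots> \<le> (\<Sum>n. ennreal (1 / e) * \<nu> (ball (c n) (s n)))"
        by (intro suminf_le mult_left_mono \<nu>_ball summableI) auto
      also have "\<dots> = ennreal (1 / e) * \<nu> E"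
        by (simp add: \<nu>E)
      finally show ?thesis .
    qed
    have "\<nu> E \<le> (\<integral>\<^sup>+y. ennreal (f y) \<partial>lborel)"
      unfolding \<nu>_def by (intro nn_integral_mono) (auto simp: indicator_def)
    also have "\<dots> = ennreal I"
      unfolding I_def using f nonneg by (intro nn_integral_eq_integral) auto
    finally have \<nu>I: "\<nu> E \<le> ennreal I" .
    have "emeasure lborel E = (\<Sum>n. emeasure lborel (ball (c n) (s n)))"
      unfolding E_def by (rule suminf_emeasure[symmetric]) (use disj in auto)
    \<comment> \<open>The volume is of order \<open>s n ^ DIM('a)\<close>; its
      \<open>\<beta>\<close> surplus powers over \<open>d\<close> are bounded by
      \<open>\<rho> powr \<beta>\<close>.\<close>
    also have "\<dots> \<le> (\<Sum>n. ennreal (\<omega> * \<rho> powr \<beta>) * ennreal (s n powr d))"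
    proof (intro suminf_le summableI)
      fix n
      have "s n ^ DIM('a) \<le> \<rho> powr \<beta> * s n powr d"
      proof (cases "s n = 0")
        case False
        with s[of n] have pos: "0 < s n" by simp
        then have "s n ^ DIM('a) = s n powr (\<beta> + d)"
          by (simp add: \<beta>_def powr_realpow)
        also have "\<dots> = s n powr \<beta> * s n powr d" by (rule powr_add)
        also have "\<dots> \<le> \<rho> powr \<beta> * s n powr d"
          using s \<beta> by (intro mult_right_mono powr_mono2) auto
        finally show ?thesis .
      qed (simp add: zero_power)
      then show "emeasure lborel (ball (c n) (s n)) \<le> ennreal (\<omega> * \<rho> powr \<beta>) * ennreal (s n powr d)"
        using s[of n] \<omega> by (simp add: emeasure_ball \<omega>_def[symmetric] mult.assoc flip: ennreal_mult)
    qed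
    also have "\<dots> = ennreal (\<omega> * \<rho> powr \<beta>) * (\<Sum>n. ennreal (s n powr d))" by simp
    also have "\<dots> \<le> ennreal (\<omega> * \<rho> powr \<beta>) * (ennreal (1 / e) * ennreal I)"
      by (intro mult_left_mono order_trans[OF sum_le] \<nu>I) auto
    also have "\<dots> = ennreal (\<omega> * \<rho> powr \<beta> * I / e)"
      using \<omega> e I by (simp flip: ennreal_mult)
    also have "\<dots> \<le> ennreal \<kappa>"
    proof (rule ennreal_leI)
      have "\<omega> * \<rho> powr \<beta> * I \<le> \<omega> * \<rho> powr \<beta> * (I + 1)"
        using \<omega> by (intro mult_left_mono) auto
      with \<rho>_powr show "\<omega> * \<rho> powr \<beta> * I / e \<le> \<kappa>" using e by (simp add: pos_divide_le_eq)
    qed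
    finally have \<nu>\<eta>: "\<nu> E \<le> ennreal (\<eta> * e / h)"
      by (intro ac) (auto simp: E_def)
    have diam: "diameter (ball (c n) (5 * s n)) = 10 * s n" for n
      using s(1)[of n] by (simp add: diameter_ball)
    have diam_le: "10 * s n \<le> \<delta>" for n using \<rho>(2) s(2)[of n] by simp
    have "hausdorff_pre d \<delta> Z \<le> (\<Sum>n. ennreal (hausdorff_const d * (diameter (ball (c n) (5 * s n)) / 2) powr d))"
      unfolding hausdorff_pre_def
    proof (rule INF_lower)
      show "(\<lambda>n. ball (c n) (5 * s n)) \<in> {C. Z \<subseteq> \<Union> (range C) \<and> (\<forall>i. bounded (C i) \<and> diameter (C i) \<le> \<delta>)}"
        using cov diam_le \<delta> by (simp add: diam del: mem_ball)
    qed
    also have "\<dots> = (\<Sum>n. ennreal h * ennreal (s n powr d))"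
      using h s hausdorff_const_pos[of d] d unfolding h_def diam
      by (intro suminf_cong) (auto simp: powr_mult mult.assoc simp flip: ennreal_mult)
    also have "\<dots> = ennreal h * (\<Sum>n. ennreal (s n powr d))" by simp
    also have "\<dots> \<le> ennreal h * (ennreal (1 / e) * ennreal (\<eta> * e / h))"
      by (intro mult_left_mono order_trans[OF sum_le] \<nu>\<eta>) auto
    also have "\<dots> = ennreal \<eta>"
      using h e \<eta> by (simp flip: ennreal_mult)
    finally show ?thesis .
  qed
  have "hausdorff_pre d \<delta> Z \<le> 0" if "0 < \<delta>" for \<delta>
    by (rule ennreal_le_epsilon) (use pre_le[OF that] in simp)
  then have "hausdorff_measure d Z \<le> 0"
    unfolding hausdorff_measure_def by (intro SUP_least) simp
  then show ?thesis by simp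
qed

section \<open>Zeros of Sobolev functions\<close>

text \<open>The increments along \<open>r / 2 ^ k\<close> are bounded by a geometric series of ratio
  \<open>2 powr - \<alpha>\<close>, and the far end of the telescope tends to 0.\<close>

lemma dyadic_telescoping:
  fixes A :: "real \<Rightarrow> real"
  assumes \<alpha>: "0 < \<alpha>" and r: "0 < r" and K: "0 \<le> K"
    and step: "\<And>t. 0 < t \<Longrightarrow> t \<le> r \<Longrightarrow> \<bar>A t - A (t / 2)\<bar> \<le> K * t powr \<alpha>"
    and lim: "(A \<longlongrightarrow> 0) (at_right 0)"
  shows "\<bar>A r\<bar> \<le> K / (1 - 2 powr - \<alpha>) * r powr \<alpha>"
proof -
  define q where "q = (2 :: real) powr - \<alpha>"
  have q: "0 < q" "q < 1" using \<alpha> by (auto simp: q_def powr_less_one)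
  have partial: "\<bar>A r - A (r / 2 ^ k)\<bar> \<le> K * r powr \<alpha> * (\<Sum>j<k. q ^ j)" for k
  proof (induction k)
    case (Suc k)
    have "(r / 2 ^ k) powr \<alpha> = r powr \<alpha> * q ^ k"
    proof -
      have "(r / 2 ^ k) powr \<alpha> = r powr \<alpha> / (2 ^ k) powr \<alpha>"
        using r by (simp add: powr_divide)
      also have "(2 ^ k :: real) powr \<alpha> = (2 powr \<alpha>) ^ k"
        by (simp add: powr_powr mult.commute flip: powr_realpow)
      finally show ?thesis by (simp add: q_def powr_minus power_inverse divide_inverse)
    qed
    moreover have "r / 2 ^ k \<le> r" "0 < r / 2 ^ k" using r by (auto simp: divide_le_eq)
    ultimately have "\<bar>A (r / 2 ^ k) - A (r / 2 ^ Suc k)\<bar> \<le> K * (r powr \<alpha> * q ^ k)"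
      using step[of "r / 2 ^ k"] by (simp add: mult.commute)
    moreover have "\<bar>A r - A (r / 2 ^ Suc k)\<bar> \<le> \<bar>A r - A (r / 2 ^ k)\<bar> + \<bar>A (r / 2 ^ k) - A (r / 2 ^ Suc k)\<bar>"
      by linarith
    ultimately show ?case using Suc.IH by (simp add: algebra_simps)
  qed simp
  have geom: "(\<Sum>j<k. q ^ j) \<le> 1 / (1 - q)" for k
    using sum_le_suminf[of "\<lambda>j. q ^ j" "{..<k}"] q suminf_geometric[of q] by (auto intro: summable_geometric)
  have bound: "\<bar>A r - A (r / 2 ^ k)\<bar> \<le> K * r powr \<alpha> * (1 / (1 - q))" for k
    using partial[of k] mult_left_mono[OF geom[of k], of "K * r powr \<alpha>"] K by simp
  have "filterlim (\<lambda>k. r / 2 ^ k) (at_right 0) sequentially"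
  proof (rule tendsto_imp_filterlim_at_right)
    have "(\<lambda>k. r * (1 / 2) ^ k) \<longlonglongrightarrow> r * 0"
      by (intro tendsto_intros LIMSEQ_power_zero) auto
    then show "(\<lambda>k. r / 2 ^ k) \<longlonglongrightarrow> 0" by (simp add: power_divide)
  qed (use r in auto)
  then have "(\<lambda>k. A (r / 2 ^ k)) \<longlonglongrightarrow> 0" by (rule filterlim_compose[OF lim])
  then have "(\<lambda>k. \<bar>A r - A (r / 2 ^ k)\<bar>) \<longlonglongrightarrow> \<bar>A r - 0\<bar>" by (intro tendsto_intros)
  then have "\<bar>A r - 0\<bar> \<le> K * r powr \<alpha> * (1 / (1 - q))"
    by (rule LIMSEQ_le_const2) (use bound in auto)
  then show ?thesis by (simp add: q_def mult_ac)
qed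

text \<open>Beyond \<open>l\<close>, write \<open>t = t powr (1 - b) * t powr b\<close>, where the
  first factor decreases in \<open>t\<close>. With a well chosen \<open>l\<close> this takes the
  place of Hoelder's inequality.\<close>

lemma le_add_powr_mult:
  fixes b t l :: real
  assumes "0 < l" "0 \<le> t" "1 \<le> b"
  shows "t \<le> l + l powr (1 - b) * t powr b"
proof (cases "t \<le> l")
  case False
  then have t: "0 < t" "l < t" using assms by auto
  have "t = t powr (1 - b) * t powr b" using t by (simp flip: powr_add)
  also have "\<dots> \<le> l powr (1 - b) * t powr b"
    using assms t by (intro mult_right_mono powr_mono2') auto
  finally show ?thesis using assms by linarith
qed (use assms in \<open>auto intro: add_increasing2\<close>)

text \<open>Either \<open>t\<close> is at least \<open>m\<close>, or \<open>(m / t) powr a\<close>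
  is at least 1. Integrated over a ball, this shows that the means of \<open>t\<close> and of its
  negative power cannot both be small.\<close>

lemma one_le_divide_add_powr:
  fixes a t m :: real
  assumes "0 < m" "0 < t" "0 < a"
  shows "1 \<le> t / m + m powr a * t powr - a"
proof (cases "m \<le> t")
  case True
  then have "1 \<le> t / m" using assms by simp
  then show ?thesis by (simp add: add_increasing2)
next
  case False
  have "1 = m powr a * m powr - a" using assms by (simp flip: powr_add)
  also have "\<dots> \<le> m powr a * t powr - a"
    using False assms by (intro mult_left_mono powr_mono2') auto
  finally show ?thesis using assms by (simp add: add_increasing)
qed

text \<open>The functions \<open>g\<close> and \<open>D i\<close> stand for Borel versions, extended by \<open>0\<close>, of the Sobolev function
  and its weak partial derivatives. Since \<open>0 powr - a = 0\<close>, the function \<open>\<bar>g\<bar> powr - a\<close> carries no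
  information where \<open>g\<close> vanishes, hence the separate assumption \<open>g_nonzero\<close>.\<close>

locale borel_sobolev =
  fixes \<Omega> :: "'n::euclidean_space set" and g :: "'n \<Rightarrow> real" and D :: "'n \<Rightarrow> 'n \<Rightarrow> real"
    and d a b :: real
  assumes open_domain: "open \<Omega>"
    and d: "0 < d" "d < real DIM('n)" and b: "1 \<le> b" and a: "0 < a"
    and exponents: "(1 - (real DIM('n) - d) / b) * a \<ge> real DIM('n) - d"
    and g_borel [measurable]: "g \<in> borel_measurable borel"
    and D_borel: "\<And>i. i \<in> Basis \<Longrightarrow> D i \<in> borel_measurable borel"
    and g_integrable: "integrable lborel (\<lambda>y. \<bar>g y\<bar> powr b)"
    and D_integrable: "\<And>i. i \<in> Basis \<Longrightarrow> integrable lborel (\<lambda>y. \<bar>D i y\<bar> powr b)"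
    and g_neg_integrable: "integrable lborel (\<lambda>y. \<bar>g y\<bar> powr - a)"
    and g_nonzero: "AE y in lborel. y \<in> \<Omega> \<longrightarrow> g y \<noteq> 0"
    and weak_derivative_test: "\<And>\<phi> i. test_fun \<Omega> \<phi> \<Longrightarrow> i \<in> Basis \<Longrightarrow>
      (\<integral>y. g y * frechet_derivative \<phi> (at y) i \<partial>lborel) = - (\<integral>y. D i y * \<phi> y \<partial>lborel)"
begin

definition "s = real DIM('n) - d"
definition "\<alpha> = 1 - s / b"
definition "\<omega> = unit_ball_vol (real DIM('n))"
text \<open>The sum of powers stands in for the \<open>b\<close>-th power of the norm of the
  gradient, to which it is comparable.\<close>

definition density :: "'n \<Rightarrow> real" where
  "density y = \<bar>g y\<bar> powr - a + (\<Sum>i\<in>Basis. \<bar>D i y\<bar> powr b)"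

lemma s_pos: "0 < s" using d by (simp add: s_def)

lemma \<alpha>: "0 < \<alpha>" "s \<le> \<alpha> * a"
proof -
  show "s \<le> \<alpha> * a" using exponents by (simp add: s_def \<alpha>_def)
  with s_pos have "0 < \<alpha> * a" by linarith
  with a show "0 < \<alpha>" by (simp add: zero_less_mult_iff)
qed

lemma \<omega>_pos: "0 < \<omega>" by (simp add: \<omega>_def)

lemma measure_ball: "0 \<le> r \<Longrightarrow> measure lborel (ball (x::'n) r) = \<omega> * r ^ DIM('n)"
  by (simp add: content_ball \<omega>_def)

lemma integrable_indicator_ball: "integrable lborel (indicator (ball x r) :: 'n \<Rightarrow> real)"
  using emeasure_bounded_finite[OF bounded_ball] by (intro integrable_real_indicator) auto

lemma integrable_on_bounded:
  fixes f :: "'n \<Rightarrow> real"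
  assumes [measurable]: "f \<in> borel_measurable borel" and f: "integrable lborel (\<lambda>y. \<bar>f y\<bar> powr b)"
    and C: "bounded C" "C \<in> sets borel"
  shows "integrable lborel (\<lambda>y. f y * indicator C y)"
proof (rule Bochner_Integration.integrable_bound)
  have "integrable lborel (indicator C :: 'n \<Rightarrow> real)"
    using emeasure_bounded_finite[OF C(1)] C(2) by (intro integrable_real_indicator) auto
  then show "integrable lborel (\<lambda>y. indicator C y + \<bar>f y\<bar> powr b)"
    using f by simp
  show "AE y in lborel. norm (f y * indicator C y) \<le> norm (indicator C y + \<bar>f y\<bar> powr b)"
    using le_add_powr_mult[of 1 "\<bar>f _\<bar>" b] b by (intro AE_I2) (auto simp: indicator_def)
qed (use C(2) in simp)

lemma density_nonneg: "0 \<le> density y"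
  by (auto simp: density_def intro!: add_nonneg_nonneg sum_nonneg)

lemma density_integrable: "integrable lborel density"
  unfolding density_def using g_neg_integrable D_integrable by auto

lemma integrable_mult_ball: "integrable lborel f \<Longrightarrow> integrable lborel (\<lambda>y. f y * indicator (ball (x::'n) r) y :: real)"
  using integrable_mult_indicator[of "ball x r" lborel f] by (simp add: mult.commute)

text \<open>A smooth function vanishing outside \<open>cball x S\<close> has its closed support in
  that compact ball, hence is a test function on \<open>\<Omega>\<close>; cutting \<open>g\<close>
  and \<open>D i\<close> off outside the ball changes neither integral.\<close>

lemma weak_gradient_ball:
  assumes "cball x S \<subseteq> \<Omega>"
  shows "weak_gradient_ball x S (\<lambda>y. g y * indicator (cball x S) y) (\<lambda>i y. D i y * indicator (cball x S) y)"
proof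
  show "integrable lborel (\<lambda>y. g y * indicator (cball x S) y)"
    using g_integrable by (intro integrable_on_bounded) auto
  show "integrable lborel (\<lambda>y. D i y * indicator (cball x S) y)" if "i \<in> Basis" for i
    using D_integrable[OF that] D_borel[OF that] by (intro integrable_on_bounded) auto
  fix \<phi> :: "'n \<Rightarrow> real" and i :: 'n
  assume \<phi>: "smooth_fun \<phi>" "\<And>y. y \<notin> cball x S \<Longrightarrow> \<phi> y = 0" and i: "i \<in> Basis"
  have sub: "closure {y. \<phi> y \<noteq> 0} \<subseteq> cball x S"
    by (rule closure_minimal) (use \<phi>(2) in blast, simp)
  have "bounded {y. \<phi> y \<noteq> 0}"
    by (rule bounded_subset[OF bounded_cball subset_trans[OF closure_subset sub]])
  then have "test_fun \<Omega> \<phi>"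
    unfolding test_fun_def using \<phi>(1) assms sub by (simp add: compact_closure)
  from weak_derivative_test[OF this i]
  have "(\<integral>y. g y * frechet_derivative \<phi> (at y) i \<partial>lborel) = - (\<integral>y. D i y * \<phi> y \<partial>lborel)" .
  moreover have "g y * indicator (cball x S) y * frechet_derivative \<phi> (at y) i = g y * frechet_derivative \<phi> (at y) i" for y
    by (cases "y \<in> cball x S") (simp_all add: smooth_fun_derivative_outside[OF \<phi>] del: mem_cball)
  moreover have "D i y * indicator (cball x S) y * \<phi> y = D i y * \<phi> y" for y
    using \<phi>(2)[of y] by (auto simp: indicator_def)
  ultimately show "(\<integral>y. g y * indicator (cball x S) y * frechet_derivative \<phi> (at y) i \<partial>lborel)
      = - (\<integral>y. D i y * indicator (cball x S) y * \<phi> y \<partial>lborel)"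
    by (simp only:)
qed

section \<open>Decay of oscillations and means on balls\<close>

definition ball_mean :: "'n \<Rightarrow> real \<Rightarrow> real" where
  "ball_mean x r = (\<integral>y. g y * indicator (ball x r) y \<partial>lborel) / measure lborel (ball x r)"

text \<open>\<open>K\<^sub>1\<close> bounds the oscillation (Poincare's constant times the gradient
  bound on the ball of radius \<open>8 * r\<close>), \<open>K\<^sub>2\<close> the mean after
  telescoping, and \<open>K\<^sub>3\<close> the integral of \<open>\<bar>g\<bar>\<close>. None
  depends on the point, the radius or \<open>e\<close>.\<close>

definition "K\<^sub>1 = 2 ^ (DIM('n) + 1) * exp (4 / 3) * real DIM('n) * (\<omega> + 1) * 8 powr (real DIM('n) - s / b)"
definition "K\<^sub>2 = 2 ^ DIM('n) * K\<^sub>1 / \<omega> / (1 - 2 powr - \<alpha>)"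
definition "K\<^sub>3 = K\<^sub>1 + \<omega> * K\<^sub>2"

lemma K_pos: "0 < K\<^sub>1" "0 < K\<^sub>2" "0 < K\<^sub>3"
proof -
  show 1: "0 < K\<^sub>1" using \<omega>_pos by (auto simp: K\<^sub>1_def intro!: mult_pos_pos add_pos_pos)
  have "(2::real) powr - \<alpha> < 1" using \<alpha>(1) by (intro powr_less_one) auto
  with 1 \<omega>_pos show 2: "0 < K\<^sub>2" by (simp add: K\<^sub>2_def)
  from 1 2 \<omega>_pos show "0 < K\<^sub>3" by (simp add: K\<^sub>3_def add_pos_pos)
qed

lemma gradient_le:
  assumes i: "i \<in> Basis" and R: "0 < R" and e: "0 < e"
    and small: "(\<integral>y. density y * indicator (ball x R) y \<partial>lborel) \<le> e * R powr d"
  shows "(\<integral>y. \<bar>D i y\<bar> * indicator (ball x R) y \<partial>lborel)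
    \<le> (\<omega> + 1) * e powr (1 / b) * R powr (real DIM('n) - s / b)"
proof -
  \<comment> \<open>This choice gives \<open>l powr b = e * R powr - s\<close>, which balances the
    two terms: both become multiples of \<open>l * R ^ DIM('n)\<close>.\<close>
  define l where "l = e powr (1 / b) * R powr (- (s / b))"
  have l: "0 < l" using R e by (simp add: l_def)
  have [measurable]: "D i \<in> borel_measurable borel" using D_borel[OF i] .
  have int: "integrable lborel (\<lambda>y. D i y * indicator (ball x R) y)"
    using D_integrable[OF i] by (intro integrable_on_bounded) auto
  have "(\<integral>y. \<bar>D i y\<bar> * indicator (ball x R) y \<partial>lborel)
      \<le> (\<integral>y. l * indicator (ball x R) y + l powr (1 - b) * (density y * indicator (ball x R) y) \<partial>lborel)"
  proof (rule integral_mono)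
    show "integrable lborel (\<lambda>y. \<bar>D i y\<bar> * indicator (ball x R) y)"
      using integrable_abs[OF int] by (simp add: abs_mult)
    show "integrable lborel (\<lambda>y. l * indicator (ball x R) y + l powr (1 - b) * (density y * indicator (ball x R) y))"
      by (intro Bochner_Integration.integrable_add Bochner_Integration.integrable_mult_right
          integrable_indicator_ball integrable_mult_ball density_integrable)
    fix y
    have "\<bar>D i y\<bar> powr b \<le> (\<Sum>i\<in>Basis. \<bar>D i y\<bar> powr b)"
      using i by (intro member_le_sum) auto
    then have "\<bar>D i y\<bar> powr b \<le> density y" by (simp add: density_def add_increasing)
    then have "l powr (1 - b) * \<bar>D i y\<bar> powr b \<le> l powr (1 - b) * density y"
      by (intro mult_left_mono) auto
    then show "\<bar>D i y\<bar> * indicator (ball x R) y \<le> l * indicator (ball x R) y + l powr (1 - b) * (density y * indicator (ball x R) y)"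
      using le_add_powr_mult[OF l, of "\<bar>D i y\<bar>" b] b by (auto simp: indicator_def)
  qed
  also have "\<dots> = l * (\<omega> * R ^ DIM('n)) + l powr (1 - b) * (\<integral>y. density y * indicator (ball x R) y \<partial>lborel)"
    using R integrable_indicator_ball[of x R] integrable_mult_ball[OF density_integrable, of x R]
    by (simp add: measure_ball)
  also have "\<dots> \<le> l * (\<omega> * R ^ DIM('n)) + l powr (1 - b) * (e * R powr d)"
    by (intro add_left_mono mult_left_mono small) auto
  also have "l powr (1 - b) * (e * R powr d) = l * R ^ DIM('n)"
  proof -
    have "l powr b = e * R powr - s"
      using b R e by (simp add: l_def powr_mult powr_powr)
    then have "l powr (1 - b) = l / (e * R powr - s)"
      using l by (simp add: powr_diff)
    moreover have "R ^ DIM('n) = R powr s * R powr d"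
      using R by (simp add: s_def powr_realpow flip: powr_add)
    ultimately show ?thesis using e R by (simp add: powr_minus field_simps)
  qed
  also have "l * (\<omega> * R ^ DIM('n)) + l * R ^ DIM('n) = (\<omega> + 1) * (l * R ^ DIM('n))"
    by (simp add: algebra_simps)
  also have "l * R ^ DIM('n) = e powr (1 / b) * R powr (real DIM('n) - s / b)"
    using R by (simp add: l_def powr_realpow[symmetric] powr_diff powr_minus field_simps)
  finally show ?thesis by (simp add: mult_ac)
qed

text \<open>Poincare's inequality on \<open>ball x r\<close> needs the gradient on
  \<open>cball x (4 * r)\<close>, which lies in the open ball of radius \<open>8 * r\<close> where
  the density is controlled. The powers of \<open>r\<close> add up to
  \<open>1 + DIM('n) - s / b = DIM('n) + \<alpha>\<close>.\<close>

lemma oscillation_le: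
  assumes r: "0 < r" and sub: "cball x (4 * r) \<subseteq> \<Omega>" and e: "0 < e"
    and small: "(\<integral>y. density y * indicator (ball x (8 * r)) y \<partial>lborel) \<le> e * (8 * r) powr d"
  shows "(\<integral>y. \<bar>g y - ball_mean x r\<bar> * indicator (ball x r) y \<partial>lborel)
    \<le> K\<^sub>1 * e powr (1 / b) * r powr (real DIM('n) + \<alpha>)"
proof -
  interpret W: weak_gradient_ball x "4 * r" "\<lambda>y. g y * indicator (cball x (4 * r)) y" "\<lambda>i y. D i y * indicator (cball x (4 * r)) y"
    by (rule weak_gradient_ball[OF sub])
  have eq: "indicator (cball x (4 * r)) y * indicator (ball x r) y = (indicator (ball x r) y :: real)" for y
    using r by (auto simp: indicator_def)
  have mean: "W.mean r = ball_mean x r"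
    by (simp add: W.mean_def ball_mean_def mult.assoc eq)
  have "W.grad_norm \<le> (\<Sum>i\<in>(Basis::'n set). (\<omega> + 1) * e powr (1 / b) * (8 * r) powr (real DIM('n) - s / b))"
    unfolding W.grad_norm_def
  proof (rule sum_mono)
    fix i :: 'n assume i: "i \<in> Basis"
    have int: "integrable lborel (\<lambda>y. D i y * indicator C y)" if "bounded C" "C \<in> sets borel" for C
      using D_integrable[OF i] D_borel[OF i] that by (intro integrable_on_bounded) auto
    have "(\<integral>y. \<bar>D i y * indicator (cball x (4 * r)) y\<bar> \<partial>lborel) \<le> (\<integral>y. \<bar>D i y * indicator (ball x (8 * r)) y\<bar> \<partial>lborel)"
      using r by (intro integral_mono integrable_abs int) (auto simp: indicator_def)
    also have "\<dots> = (\<integral>y. \<bar>D i y\<bar> * indicator (ball x (8 * r)) y \<partial>lborel)"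
      by (simp add: abs_mult)
    also have "\<dots> \<le> (\<omega> + 1) * e powr (1 / b) * (8 * r) powr (real DIM('n) - s / b)"
      using r by (intro gradient_le i e small) auto
    finally show "(\<integral>y. \<bar>D i y * indicator (cball x (4 * r)) y\<bar> \<partial>lborel) \<le> (\<omega> + 1) * e powr (1 / b) * (8 * r) powr (real DIM('n) - s / b)" .
  qed
  then have N: "W.grad_norm \<le> real DIM('n) * ((\<omega> + 1) * e powr (1 / b) * (8 * r) powr (real DIM('n) - s / b))"
    by simp
  have "(\<integral>y. \<bar>g y - ball_mean x r\<bar> * indicator (ball x r) y \<partial>lborel)
      = (\<integral>y. \<bar>g y * indicator (cball x (4 * r)) y - W.mean r\<bar> * indicator (ball x r) y \<partial>lborel)"
    unfolding mean using r by (intro Bochner_Integration.integral_cong) (auto simp: indicator_def)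
  also have "\<dots> \<le> 2 ^ (DIM('n) + 1) * exp (4 / 3) * r * W.grad_norm"
    by (rule W.poincare[OF r refl])
  also have "\<dots> \<le> 2 ^ (DIM('n) + 1) * exp (4 / 3) * r
      * (real DIM('n) * ((\<omega> + 1) * e powr (1 / b) * (8 * r) powr (real DIM('n) - s / b)))"
    using r by (intro mult_left_mono N) auto
  also have "\<dots> = K\<^sub>1 * e powr (1 / b) * (r * r powr (real DIM('n) - s / b))"
    using r by (simp add: K\<^sub>1_def powr_mult)
  also have "r * r powr (real DIM('n) - s / b) = r powr (real DIM('n) + \<alpha>)"
    using r powr_add[of r 1 "real DIM('n) - s / b"] by (simp add: \<alpha>_def algebra_simps)
  finally show ?thesis .
qed

lemma integrable_g_diff: "integrable lborel (\<lambda>y. (g y - c) * indicator (ball x r) y)"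
proof -
  have "integrable lborel (\<lambda>y. g y * indicator (ball x r) y)"
    using g_integrable by (intro integrable_on_bounded) auto
  from Bochner_Integration.integrable_diff[OF this Bochner_Integration.integrable_mult_right[OF integrable_indicator_ball, of c x r]]
  show ?thesis by (simp add: left_diff_distrib)
qed

lemma integrable_abs_g_diff: "integrable lborel (\<lambda>y. \<bar>g y - c\<bar> * indicator (ball x r) y)"
  using integrable_abs[OF integrable_g_diff] by (simp add: abs_mult)

text \<open>The difference of the means is at most the average of
  \<open>\<bar>g y - ball_mean x r\<bar>\<close> over the half ball; enlarging the domain to the
  full ball costs \<open>2 ^ DIM('n)\<close>.\<close>

lemma ball_mean_half:
  assumes r: "0 < r" and osc: "(\<integral>y. \<bar>g y - ball_mean x r\<bar> * indicator (ball x r) y \<partial>lborel)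
    \<le> K * r powr (real DIM('n) + \<alpha>)"
  shows "\<bar>ball_mean x r - ball_mean x (r / 2)\<bar> \<le> 2 ^ DIM('n) * K / \<omega> * r powr \<alpha>"
proof -
  define c where "c = ball_mean x r"
  define m where "m = \<omega> * (r / 2) ^ DIM('n)"
  have m: "0 < m" using r \<omega>_pos by (simp add: m_def)
  have "(\<integral>y. (g y - c) * indicator (ball x (r / 2)) y \<partial>lborel) = m * (ball_mean x (r / 2) - c)"
  proof -
    have "integrable lborel (\<lambda>y. g y * indicator (ball x (r / 2)) y)"
      using g_integrable by (intro integrable_on_bounded) auto
    then have "(\<integral>y. (g y - c) * indicator (ball x (r / 2)) y \<partial>lborel)
        = (\<integral>y. g y * indicator (ball x (r / 2)) y \<partial>lborel) - c * m"
      using integrable_indicator_ball[of x "r / 2"] r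
      by (simp add: left_diff_distrib measure_ball m_def)
    then show ?thesis
      using m r by (simp add: ball_mean_def measure_ball m_def[symmetric] right_diff_distrib)
  qed
  then have "m * \<bar>c - ball_mean x (r / 2)\<bar> = \<bar>\<integral>y. (g y - c) * indicator (ball x (r / 2)) y \<partial>lborel\<bar>"
    using m by (simp add: abs_mult abs_minus_commute)
  also have "\<dots> \<le> (\<integral>y. \<bar>(g y - c) * indicator (ball x (r / 2)) y\<bar> \<partial>lborel)"
    by (rule integral_abs_bound)
  also have "\<dots> \<le> (\<integral>y. \<bar>g y - c\<bar> * indicator (ball x r) y \<partial>lborel)"
    using r by (intro integral_mono integrable_abs integrable_g_diff integrable_abs_g_diff)
      (auto simp: indicator_def)
  also have "\<dots> \<le> K * r powr (real DIM('n) + \<alpha>)"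
    using osc by (simp add: c_def)
  also have "\<dots> = m * (2 ^ DIM('n) * K / \<omega> * r powr \<alpha>)"
    using r \<omega>_pos by (simp add: m_def powr_add powr_realpow power_divide)
  finally show ?thesis using m unfolding c_def by (simp only: mult_le_cancel_left_pos)
qed

text \<open>The constant \<open>e\<close> is chosen before the point \<open>x\<close>, as the
  covering argument needs a common lower density bound. At each point, a smaller density at all
  small radii is contradicted at one suitable radius.\<close>

lemma dense_at_zero:
  "\<exists>e>0. \<forall>x\<in>\<Omega>. (ball_mean x \<longlongrightarrow> 0) (at_right 0) \<longrightarrow>
      (\<forall>\<delta>>0. \<exists>r>0. r < \<delta> \<and> e * r powr d \<le> (\<integral>y. density y * indicator (ball x r) y \<partial>lborel))"
proof -
  \<comment> \<open>The second entry makes \<open>(2 * K\<^sub>3 / \<omega>) powr a * e\<close> at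
    most \<open>\<omega> / 2\<close>; the first ensures \<open>\<theta> \<le> 1\<close>.\<close>
  define e where "e = min 1 (\<omega> / (2 * (2 * K\<^sub>3 / \<omega>) powr a))"
  have e: "0 < e" "e \<le> 1" using \<omega>_pos K_pos by (auto simp: e_def)
  have "\<exists>r. 0 < r \<and> r < \<delta> \<and> e * r powr d \<le> (\<integral>y. density y * indicator (ball x r) y \<partial>lborel)"
    if x: "x \<in> \<Omega>" and lim: "(ball_mean x \<longlongrightarrow> 0) (at_right 0)" and \<delta>: "0 < \<delta>" for x \<delta>
  proof (rule ccontr)
    assume "\<not> ?thesis"
    then have small: "(\<integral>y. density y * indicator (ball x r) y \<partial>lborel) < e * r powr d" if "0 < r" "r < \<delta>" for r
      using that by (meson not_le)
    obtain \<delta>' where \<delta>': "0 < \<delta>'" "cball x \<delta>' \<subseteq> \<Omega>"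
      using open_domain x open_contains_cball by blast
    \<comment> \<open>Dividing by 16 leaves room for the radii \<open>8 * r\<close> below
      \<open>\<delta>\<close> and \<open>4 * r\<close> inside \<open>\<Omega>\<close>; the cap at 1
      allows exponents of \<open>r\<close> to be compared.\<close>
    define r where "r = min (min \<delta> \<delta>') 1 / 16"
    have r: "0 < r" "8 * r < \<delta>" "4 * r \<le> \<delta>'" "r \<le> 1"
      using \<delta> \<delta>' by (auto simp: r_def min_def)
    define \<theta> where "\<theta> = e powr (1 / b)"
    have \<theta>: "0 < \<theta>" using e by (simp add: \<theta>_def)
    have osc: "(\<integral>y. \<bar>g y - ball_mean x t\<bar> * indicator (ball x t) y \<partial>lborel)
        \<le> K\<^sub>1 * \<theta> * t powr (real DIM('n) + \<alpha>)" if "0 < t" "t \<le> r" for t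
      unfolding \<theta>_def
    proof (rule oscillation_le[OF that(1) _ e(1)])
      show "cball x (4 * t) \<subseteq> \<Omega>" using \<delta>'(2) r(3) that(2) by (auto simp: subset_iff)
      show "(\<integral>y. density y * indicator (ball x (8 * t)) y \<partial>lborel) \<le> e * (8 * t) powr d"
        using small[of "8 * t"] that r by simp
    qed
    have mean_le: "\<bar>ball_mean x r\<bar> \<le> K\<^sub>2 * \<theta> * r powr \<alpha>"
    proof -
      have "\<bar>ball_mean x r\<bar> \<le> 2 ^ DIM('n) * (K\<^sub>1 * \<theta>) / \<omega> / (1 - 2 powr - \<alpha>) * r powr \<alpha>"
      proof (rule dyadic_telescoping[OF \<alpha>(1) r(1) _ _ lim])
        show "0 \<le> 2 ^ DIM('n) * (K\<^sub>1 * \<theta>) / \<omega>" using K_pos \<omega>_pos \<theta> by simp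
        show "\<bar>ball_mean x t - ball_mean x (t / 2)\<bar> \<le> 2 ^ DIM('n) * (K\<^sub>1 * \<theta>) / \<omega> * t powr \<alpha>"
          if "0 < t" "t \<le> r" for t
          by (rule ball_mean_half[OF that(1) osc[OF that]])
      qed
      then show ?thesis by (simp add: K\<^sub>2_def)
    qed
    define n where "n = DIM('n)"
    have abs_g: "(\<integral>y. \<bar>g y\<bar> * indicator (ball x r) y \<partial>lborel) \<le> K\<^sub>3 * \<theta> * (r ^ n * r powr \<alpha>)"
    proof -
      have "(\<integral>y. \<bar>g y\<bar> * indicator (ball x r) y \<partial>lborel)
          \<le> (\<integral>y. \<bar>g y - ball_mean x r\<bar> * indicator (ball x r) y + \<bar>ball_mean x r\<bar> * indicator (ball x r) y \<partial>lborel)"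
        using integrable_abs_g_diff[of 0 x r] integrable_abs_g_diff[of "ball_mean x r" x r]
        by (intro integral_mono Bochner_Integration.integrable_add Bochner_Integration.integrable_mult_right
            integrable_indicator_ball) (auto simp: indicator_def)
      also have "\<dots> = (\<integral>y. \<bar>g y - ball_mean x r\<bar> * indicator (ball x r) y \<partial>lborel) + \<bar>ball_mean x r\<bar> * (\<omega> * r ^ n)"
        using integrable_abs_g_diff[of "ball_mean x r" x r] integrable_indicator_ball[of x r] r
        by (simp add: measure_ball n_def)
      also have "\<dots> \<le> K\<^sub>1 * \<theta> * (r ^ n * r powr \<alpha>) + K\<^sub>2 * \<theta> * r powr \<alpha> * (\<omega> * r ^ n)"
        using osc[OF r(1) order_refl] mean_le r \<omega>_pos
        by (intro add_mono mult_right_mono) (auto simp: n_def powr_add powr_realpow)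
      also have "\<dots> = K\<^sub>3 * \<theta> * (r ^ n * r powr \<alpha>)" by (simp add: K\<^sub>3_def algebra_simps)
      finally show ?thesis .
    qed
    \<comment> \<open>Twice the bound just obtained for the mean of \<open>\<bar>g\<bar>\<close>, so
      that the integral of \<open>\<bar>g\<bar> / M\<close> accounts for at most half the volume of
      the ball.\<close>
    define M where "M = 2 * K\<^sub>3 / \<omega> * \<theta> * r powr \<alpha>"
    have M: "0 < M" using K_pos \<omega>_pos \<theta> r by (simp add: M_def)
    have "(\<integral>y. indicator (ball x r) y \<partial>lborel)
        \<le> (\<integral>y. (\<bar>g y\<bar> * indicator (ball x r) y) / M + M powr a * (density y * indicator (ball x r) y) \<partial>lborel)"
    proof (rule integral_mono_AE)
      show "integrable lborel (\<lambda>y. (\<bar>g y\<bar> * indicator (ball x r) y) / M + M powr a * (density y * indicator (ball x r) y))"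
        using integrable_abs_g_diff[of 0 x r] density_integrable
        by (intro Bochner_Integration.integrable_add Bochner_Integration.integrable_mult_right integrable_mult_ball) auto
      show "AE y in lborel. indicator (ball x r) y
          \<le> (\<bar>g y\<bar> * indicator (ball x r) y) / M + M powr a * (density y * indicator (ball x r) y)"
        using g_nonzero
      proof eventually_elim
        case (elim y)
        show ?case
        proof (cases "y \<in> ball x r")
          case True
          then have "y \<in> \<Omega>" using \<delta>'(2) r(1,3) by (auto simp: subset_iff)
          with elim have "0 < \<bar>g y\<bar>" by simp
          from one_le_divide_add_powr[OF M this a]
          have "1 \<le> \<bar>g y\<bar> / M + M powr a * \<bar>g y\<bar> powr - a" .
          also have "\<dots> \<le> \<bar>g y\<bar> / M + M powr a * density y"
            by (intro add_left_mono mult_left_mono) (auto simp: density_def intro: sum_nonneg)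
          finally show ?thesis using True by simp
        qed simp
      qed
    qed (rule integrable_indicator_ball)
    also have "\<dots> = (\<integral>y. \<bar>g y\<bar> * indicator (ball x r) y \<partial>lborel) / M + M powr a * (\<integral>y. density y * indicator (ball x r) y \<partial>lborel)"
      using integrable_abs_g_diff[of 0 x r] integrable_mult_ball[OF density_integrable, of x r] by simp
    also have "\<dots> < K\<^sub>3 * \<theta> * (r ^ n * r powr \<alpha>) / M + M powr a * (e * r powr d)"
      using M abs_g small[of r] r by (intro add_le_less_mono divide_right_mono mult_strict_left_mono) auto
    also have "K\<^sub>3 * \<theta> * (r ^ n * r powr \<alpha>) / M = \<omega> * r ^ n / 2"
      using K_pos \<omega>_pos \<theta> r by (simp add: M_def)
    also have "M powr a * (e * r powr d) \<le> \<omega> * r ^ n / 2"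
    proof -
      \<comment> \<open>The other half: \<open>\<theta> powr a\<close> is simply bounded by 1, and
        the smallness comes from the factor \<open>e\<close>.\<close>
      have "\<theta> \<le> 1" using e b by (auto simp: \<theta>_def intro: powr_le1)
      then have \<theta>a: "\<theta> powr a \<le> 1" using \<theta> a by (intro powr_le1) auto
      have "M powr a * r powr d = (2 * K\<^sub>3 / \<omega>) powr a * \<theta> powr a * r powr (\<alpha> * a + d)"
      proof -
        define L where "L = 2 * K\<^sub>3 / \<omega>"
        have "0 < L" using K_pos \<omega>_pos by (simp add: L_def)
        moreover have "M = L * \<theta> * r powr \<alpha>" by (simp add: M_def L_def)
        ultimately show ?thesis
          using \<theta> r unfolding L_def[symmetric] by (simp add: powr_mult powr_powr powr_add)
      qed
      also have "\<dots> \<le> (2 * K\<^sub>3 / \<omega>) powr a * 1 * r powr (real n)"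
      proof (rule mult_mono)
        show "(2 * K\<^sub>3 / \<omega>) powr a * \<theta> powr a \<le> (2 * K\<^sub>3 / \<omega>) powr a * 1"
          by (rule mult_left_mono[OF \<theta>a]) simp
        \<comment> \<open>The exponent condition enters here: \<open>\<alpha> * a + d\<close> is at
          least \<open>s + d = DIM('n)\<close>, and \<open>r \<le> 1\<close>.\<close>
        show "r powr (\<alpha> * a + d) \<le> r powr (real n)"
          using r \<alpha>(2) by (intro powr_mono') (auto simp: s_def n_def)
      qed auto
      finally have "M powr a * r powr d * e \<le> (2 * K\<^sub>3 / \<omega>) powr a * r ^ n * e"
        using e r by (intro mult_right_mono) (auto simp: powr_realpow)
      also have "\<dots> = ((2 * K\<^sub>3 / \<omega>) powr a * e) * r ^ n" by simp
      also have "\<dots> \<le> \<omega> / 2 * r ^ n"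
      proof (rule mult_right_mono)
        have p: "0 < (2 * K\<^sub>3 / \<omega>) powr a" using K_pos \<omega>_pos by simp
        have "e \<le> \<omega> / (2 * (2 * K\<^sub>3 / \<omega>) powr a)" by (simp add: e_def)
        then have "(2 * K\<^sub>3 / \<omega>) powr a * e \<le> (2 * K\<^sub>3 / \<omega>) powr a * (\<omega> / (2 * (2 * K\<^sub>3 / \<omega>) powr a))"
          using p by (intro mult_left_mono) auto
        also have "\<dots> = \<omega> / 2" using p by (simp add: divide_simps)
        finally show "(2 * K\<^sub>3 / \<omega>) powr a * e \<le> \<omega> / 2" .
      qed (use r in auto)
      finally show ?thesis by (simp add: mult_ac)
    qed
    also have "(\<integral>y. indicator (ball x r) y \<partial>lborel) = \<omega> * r ^ n"
      using r by (simp add: measure_ball n_def)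
    finally show False by simp
  qed
  with e(1) show ?thesis by auto
qed

lemma hausdorff_measure_zero_set:
  "hausdorff_measure d {x \<in> \<Omega>. (ball_mean x \<longlongrightarrow> 0) (at_right 0)} = 0"
proof -
  obtain e where "0 < e" "\<forall>x\<in>\<Omega>. (ball_mean x \<longlongrightarrow> 0) (at_right 0) \<longrightarrow>
      (\<forall>\<delta>>0. \<exists>r>0. r < \<delta> \<and> e * r powr d \<le> (\<integral>y. density y * indicator (ball x r) y \<partial>lborel))"
    using dense_at_zero by blast
  then show ?thesis
    by (intro hausdorff_measure_dense_points_eq_0[OF density_integrable density_nonneg d]) auto
qed

end

section \<open>Passage from Lebesgue to Borel measurable functions\<close>

text \<open>A Lebesgue measurable function agrees almost everywhere with a Borel one. Extension by 0
  keeps the power integrable on the whole space, since \<open>0 powr p = 0\<close>.\<close>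

lemma borel_version:
  fixes f :: "'a::euclidean_space \<Rightarrow> real"
  assumes "Lp_on p \<Omega> f"
  shows "\<exists>f'\<in>borel_measurable borel. (AE y in lborel. indicator \<Omega> y * f y = f' y) \<and>
    integrable lborel (\<lambda>y. \<bar>f' y\<bar> powr p)"
proof -
  have m: "(\<lambda>y. indicator \<Omega> y * f y) \<in> borel_measurable lebesgue"
    and int: "integrable lebesgue (\<lambda>y. indicator \<Omega> y * \<bar>f y\<bar> powr p)"
    using assms by (auto simp: Lp_on_def set_borel_measurable_def set_integrable_def)
  from completion_ex_borel_measurable_real[OF m]
  obtain f' where f' [measurable]: "f' \<in> borel_measurable borel"
    and eq: "AE y in lborel. indicator \<Omega> y * f y = f' y" by auto
  have "integrable lebesgue (\<lambda>y. \<bar>f' y\<bar> powr p)"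
  proof (rule integrable_cong_AE_imp[OF int])
    show "(\<lambda>y. \<bar>f' y\<bar> powr p) \<in> borel_measurable lebesgue"
      by (rule measurable_completion) measurable
    show "AE y in lebesgue. indicator \<Omega> y * \<bar>f y\<bar> powr p = \<bar>f' y\<bar> powr p"
      using AE_completion[OF eq]
    proof eventually_elim
      case (elim y)
      show ?case unfolding elim[symmetric] by (simp add: indicator_def)
    qed
  qed
  then have "integrable lborel (\<lambda>y. \<bar>f' y\<bar> powr p)"
    by (subst (asm) integrable_completion) measurable
  with f' eq show ?thesis by blast
qed

text \<open>Measurability of \<open>f\<close> is known only on \<open>\<Omega>\<close>, so the
  indicator is grouped with \<open>f\<close> before the almost everywhere identity is used.\<close>

lemma integral_borel_version:
  fixes f f' k :: "'a::euclidean_space \<Rightarrow> real"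
  assumes f: "(\<lambda>y. indicator \<Omega> y * f y) \<in> borel_measurable lebesgue"
    and f' [measurable]: "f' \<in> borel_measurable borel" and k [measurable]: "k \<in> borel_measurable borel"
    and eq: "AE y in lborel. indicator \<Omega> y * f y = f' y"
  shows "(LINT y|lebesgue. indicator \<Omega> y * (f y * k y)) = (\<integral>y. f' y * k y \<partial>lborel)"
proof -
  have "(LINT y|lebesgue. indicator \<Omega> y * (f y * k y)) = (LINT y|lebesgue. f' y * k y)"
  proof (rule integral_cong_AE)
    have "k \<in> borel_measurable lebesgue" using k by (simp add: measurable_completion)
    with f have "(\<lambda>y. (indicator \<Omega> y * f y) * k y) \<in> borel_measurable lebesgue"
      by (rule borel_measurable_times)
    then show "(\<lambda>y. indicator \<Omega> y * (f y * k y)) \<in> borel_measurable lebesgue"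
      by (simp only: mult.assoc)
    show "(\<lambda>y. f' y * k y) \<in> borel_measurable lebesgue"
      by (rule measurable_completion) measurable
    show "AE y in lebesgue. indicator \<Omega> y * (f y * k y) = f' y * k y"
      using AE_completion[OF eq] by eventually_elim (simp add: mult.assoc[symmetric])
  qed
  also have "\<dots> = (\<integral>y. f' y * k y \<partial>lborel)"
    by (rule integral_completion) measurable
  finally show ?thesis .
qed

lemma test_fun_measurable:
  fixes \<phi> :: "'a::euclidean_space \<Rightarrow> real"
  assumes "test_fun \<Omega> \<phi>"
  shows "\<phi> \<in> borel_measurable borel" "(\<lambda>y. frechet_derivative \<phi> (at y) i) \<in> borel_measurable borel"
  using assms unfolding test_fun_def
  by (auto intro!: borel_measurable_continuous_onI smooth_fun_continuous smooth_fun_continuous_derivative)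

theorem mainTheorem7:
  fixes \<Omega> :: "'n::euclidean_space set" and g :: "'n \<Rightarrow> real" and d a b :: real
  assumes "open \<Omega>"
    and "0 < d" and "d < real DIM('n)"
    and "1 \<le> b" and "0 < a"
    and "(1 - (real DIM('n) - d) / b) * a \<ge> real DIM('n) - d"
    and "sobolev_W1 b \<Omega> g"
    and "(\<integral>\<^sup>+ x. neg_pow a (g x) * indicator \<Omega> x \<partial>lebesgue) < \<infinity>"
  shows "hausdorff_measure d (precise_zero_set \<Omega> g) = 0"
proof -
  have [measurable]: "\<Omega> \<in> sets borel" using assms(1) by simp
  obtain G where Lp_g: "Lp_on b \<Omega> g" and Lp_G: "\<And>i. i \<in> Basis \<Longrightarrow> Lp_on b \<Omega> (\<lambda>x. G x \<bullet> i)"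
    and weak: "\<And>\<phi> i. test_fun \<Omega> \<phi> \<Longrightarrow> i \<in> Basis \<Longrightarrow>
      (LINT x:\<Omega>|lebesgue. g x * frechet_derivative \<phi> (at x) i) = - (LINT x:\<Omega>|lebesgue. (G x \<bullet> i) * \<phi> x)"
    using assms(7) unfolding sobolev_W1_def by auto
  obtain g' where g' [measurable]: "g' \<in> borel_measurable borel"
    and g'_eq: "AE y in lborel. indicator \<Omega> y * g y = g' y"
    and g'_int: "integrable lborel (\<lambda>y. \<bar>g' y\<bar> powr b)"
    using borel_version[OF Lp_g] by blast
  have "\<exists>D. \<forall>i\<in>Basis. D i \<in> borel_measurable borel \<and> (AE y in lborel. indicator \<Omega> y * (G y \<bullet> i) = D i y) \<and>
      integrable lborel (\<lambda>y. \<bar>D i y\<bar> powr b)"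
    using borel_version[OF Lp_G] by (intro bchoice) blast
  then obtain D where D: "\<And>i. i \<in> Basis \<Longrightarrow> D i \<in> borel_measurable borel"
    "\<And>i. i \<in> Basis \<Longrightarrow> AE y in lborel. indicator \<Omega> y * (G y \<bullet> i) = D i y"
    "\<And>i. i \<in> Basis \<Longrightarrow> integrable lborel (\<lambda>y. \<bar>D i y\<bar> powr b)" by blast
  have [measurable]: "(\<lambda>y. neg_pow a (g' y)) \<in> borel_measurable borel"
    unfolding neg_pow_def by measurable
  have "(\<integral>\<^sup>+y. neg_pow a (g' y) * indicator \<Omega> y \<partial>lborel) = (\<integral>\<^sup>+y. neg_pow a (g y) * indicator \<Omega> y \<partial>lborel)"
    by (rule nn_integral_cong_AE) (use g'_eq in \<open>eventually_elim, auto simp: indicator_def\<close>)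
  also have "\<dots> < \<infinity>"
    using assms(8) by (simp add: nn_integral_completion)
  finally have fin: "(\<integral>\<^sup>+y. neg_pow a (g' y) * indicator \<Omega> y \<partial>lborel) < \<infinity>" .
  \<comment> \<open>Since \<open>neg_pow\<close> is infinite at 0, finiteness of its integral
    excludes zeros of \<open>g'\<close> in \<open>\<Omega>\<close> outside a null set.\<close>
  have "AE y in lborel. neg_pow a (g' y) * indicator \<Omega> y \<noteq> \<infinity>"
    by (rule nn_integral_noteq_infinite) (use fin in auto)
  then have nonzero: "AE y in lborel. y \<in> \<Omega> \<longrightarrow> g' y \<noteq> 0"
    by eventually_elim (auto simp: neg_pow_def)
  have neg_int: "integrable lborel (\<lambda>y. \<bar>g' y\<bar> powr - a)"
  proof (rule integrableI_bounded)
    have "(\<integral>\<^sup>+y. ennreal (norm (\<bar>g' y\<bar> powr - a)) \<partial>lborel) \<le> (\<integral>\<^sup>+y. neg_pow a (g' y) * indicator \<Omega> y \<partial>lborel)"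
    proof (rule nn_integral_mono_AE)
      \<comment> \<open>Outside \<open>\<Omega>\<close> the function \<open>g'\<close> vanishes
        almost everywhere, and there the left side is 0 by the convention
        \<open>0 powr - a = 0\<close>.\<close>
      show "AE y in lborel. ennreal (norm (\<bar>g' y\<bar> powr - a)) \<le> neg_pow a (g' y) * indicator \<Omega> y"
        using g'_eq by eventually_elim (auto simp: neg_pow_def indicator_def split: if_splits)
    qed
    with fin show "(\<integral>\<^sup>+y. ennreal (norm (\<bar>g' y\<bar> powr - a)) \<partial>lborel) < \<infinity>" by simp
  qed measurable
  have g_meas: "(\<lambda>y. indicator \<Omega> y * g y) \<in> borel_measurable lebesgue"
    using Lp_g by (simp add: Lp_on_def set_borel_measurable_def)
  interpret borel_sobolev \<Omega> g' D d a b
  proof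
    fix \<phi> :: "'n \<Rightarrow> real" and i :: 'n
    assume \<phi>: "test_fun \<Omega> \<phi>" and i: "i \<in> Basis"
    have "(\<lambda>y. indicator \<Omega> y * (G y \<bullet> i)) \<in> borel_measurable lebesgue"
      using Lp_G[OF i] by (simp add: Lp_on_def set_borel_measurable_def)
    from integral_borel_version[OF this D(1)[OF i] test_fun_measurable(1)[OF \<phi>] D(2)[OF i]]
      integral_borel_version[OF g_meas g' test_fun_measurable(2)[OF \<phi>] g'_eq, of i]
    show "(\<integral>y. g' y * frechet_derivative \<phi> (at y) i \<partial>lborel) = - (\<integral>y. D i y * \<phi> y \<partial>lborel)"
      using weak[OF \<phi> i] by (simp add: set_lebesgue_integral_def)
  qed (use assms g'_int D nonzero neg_int in auto)
  \<comment> \<open>The means of \<open>g\<close> and \<open>g'\<close> agree once the ball lies in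
    \<open>\<Omega>\<close>; outside, \<open>g\<close> is arbitrary, so the identity is claimed for
    small radii only.\<close>
  have mean_eq: "\<forall>\<^sub>F r in at_right 0.
      (LINT y:ball x r|lebesgue. g y) / measure lebesgue (ball x r) = ball_mean x r" if x: "x \<in> \<Omega>" for x
  proof -
    obtain \<delta> where \<delta>: "0 < \<delta>" "ball x \<delta> \<subseteq> \<Omega>"
      using assms(1) x open_contains_ball by blast
    show ?thesis
    proof (rule eventually_at_rightI[OF _ \<delta>(1)])
      fix r assume "r \<in> {0<..<\<delta>}"
      then have sub: "ball x r \<subseteq> \<Omega>" using \<delta>(2) subset_ball[of r \<delta> x] by auto
      have "(LINT y:ball x r|lebesgue. g y) = (LINT y|lebesgue. indicator \<Omega> y * (g y * indicator (ball x r) y))"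
        unfolding set_lebesgue_integral_def using sub
        by (intro Bochner_Integration.integral_cong) (auto simp: indicator_def)
      also have "\<dots> = (\<integral>y. g' y * indicator (ball x r) y \<partial>lborel)"
        by (rule integral_borel_version[OF g_meas g' _ g'_eq]) (intro borel_measurable_indicator, simp)
      finally show "(LINT y:ball x r|lebesgue. g y) / measure lebesgue (ball x r) = ball_mean x r"
        by (simp add: ball_mean_def)
    qed
  qed
  have "precise_zero_set \<Omega> g = {x \<in> \<Omega>. (ball_mean x \<longlongrightarrow> 0) (at_right 0)}"
    unfolding precise_zero_set_def using tendsto_cong[OF mean_eq] by blast
  then show ?thesis by (simp add: hausdorff_measure_zero_set)
qed

end
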